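(* Let $f \colon \mathbb{R}^n \rightarrow \mathbb{R}$ be a continuous semi-algebraic function. Assume that $S := \{x \in \mathbb{R}^n : f(x) \le 0 \} \ne \emptyset$. If $f$ satisfies the Palais-Smale condition at each level $t \ge 0$, then there exist some constants $c > 0$, $\alpha > 0$, and $\beta > 0$ such that $$c\, d(x,S) \le [f(x)]_+^{\alpha} + [f(x)]_+^{\beta} \quad \text{for all } x \in \mathbb{R}^n.$$
   Context: $d(x,S)$ denotes the Euclidean distance from $x$ to $S$; $[f(x)]_+ := \max\{f(x),0\}$. A subset of $\mathbb{R}^n$ is semi-algebraic if it is a finite union of sets defined by finitely many polynomial equations $g=0$ and strict inequalities $g>0$; a function is semi-algebraic if its graph is a semi-algebraic set. For a continuous function $f\colon\mathbb{R}^n\to\mathbb{R}$, the Fréchet subdifferential at $x$ is $$\hat\partial f(x) := \Big\{v\in\mathbb{R}^n : \liminf_{\|h\|\to 0,\ h\neq 0}\frac{f(x+h)-f(x)-\langle v,h\rangle}{\|h\|}\ge 0\Big\},$$ and the limiting subdifferential $\partial f(x)$ is the set of all cluster points of sequences $\{v^k\}_{k\ge1}$ such that $v^k\in\hat\partial f(x^k)$ and $(x^k,f(x^k))\to(x,f(x))$ as $k\to\infty$. The nonsmooth slope is $\mathfrak{m}_f(x) := \inf\{\|v\| : v\in\partial f(x)\}$, with $\mathfrak{m}_f(x)=+\infty$ if $\partial f(x)=\emptyset$. For a real number $t$, $f$ satisfies the Palais-Smale condition at the level $t$ if every sequence $\{x^k\}\subset\mathbb{R}^n$ with $f(x^k)\to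 t$ and $\mathfrak{m}_f(x^k)\to 0$ as $k\to\infty$ possesses a convergent subsequence. *)

theory Defs
  imports "HOL-Analysis.Analysis"
begin

text \<open>
  On \<^typ>\<open>real^'n\<close> and on \<^typ>\<open>(real^'n) \<times> real\<close>, the predicate \<^const>\<open>real_polynomial_function\<close>
  holds exactly of the functions given by real polynomials in the coordinates. The product
  \<^typ>\<open>(real^'n) \<times> real\<close>, with its Euclidean structure, plays the role of
  \<open>(n + 1)\<close>-dimensional space.
\<close>

definition basic_semialgebraic :: "'a::euclidean_space set \<Rightarrow> bool" where
  "basic_semialgebraic A \<longleftrightarrow>
    (\<exists>E P. finite E \<and> finite P \<and>
       (\<forall>g \<in> E \<union> P. real_polynomial_function g) \<and>
       A = {x. (\<forall>g\<in>E. g x = 0) \<and> (\<forall>g\<in>P. g x > 0)})"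

definition semialgebraic :: "'a::euclidean_space set \<Rightarrow> bool" where
  "semialgebraic A \<longleftrightarrow> (\<exists>\<A>. finite \<A> \<and> (\<forall>B\<in>\<A>. basic_semialgebraic B) \<and> A = \<Union>\<A>)"

definition semialgebraic_fun :: "('a::euclidean_space \<Rightarrow> real) \<Rightarrow> bool" where
  "semialgebraic_fun f \<longleftrightarrow> semialgebraic {(x, y). y = f x}"

text \<open>
  The filter \<^term>\<open>at 0\<close> excludes \<open>h = 0\<close>. The lower limit is taken in the extended reals, since the
  difference quotient may be unbounded.
\<close>

definition frechet_subdifferential :: "('a::euclidean_space \<Rightarrow> real) \<Rightarrow> 'a \<Rightarrow> 'a set" where
  "frechet_subdifferential f x =
    {v. Liminf (at 0) (\<lambda>h. ereal ((f (x + h) - f x - v \<bullet> h) / norm h)) \<ge> 0}"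

text \<open>Cluster points of a sequence are expressed as limits of its subsequences.\<close>

definition limiting_subdifferential :: "('a::euclidean_space \<Rightarrow> real) \<Rightarrow> 'a \<Rightarrow> 'a set" where
  "limiting_subdifferential f x =
    {v. \<exists>X V. (\<forall>k. V k \<in> frechet_subdifferential f (X k)) \<and>
          (\<lambda>k. (X k, f (X k))) \<longlonglongrightarrow> (x, f x) \<and>
          (\<exists>r :: nat \<Rightarrow> nat. strict_mono r \<and> (V \<circ> r) \<longlonglongrightarrow> v)}"

text \<open>
  In the extended reals the infimum of the empty set is \<open>\<infinity>\<close>, which is the required value of the slope
  when the subdifferential is empty.
\<close>

definition nonsmooth_slope :: "('a::euclidean_space \<Rightarrow> real) \<Rightarrow> 'a \<Rightarrow> ereal" where
  "nonsmooth_slope f x = (INF v \<in> limiting_subdifferential f x. ereal (norm v))"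

definition palais_smale_at :: "('a::euclidean_space \<Rightarrow> real) \<Rightarrow> real \<Rightarrow> bool" where
  "palais_smale_at f t \<longleftrightarrow>
    (\<forall>X :: nat \<Rightarrow> 'a.
       (\<lambda>k. f (X k)) \<longlonglongrightarrow> t \<and> (\<lambda>k. nonsmooth_slope f (X k)) \<longlonglongrightarrow> 0 \<longrightarrow>
       (\<exists>r l. strict_mono (r :: nat \<Rightarrow> nat) \<and> (X \<circ> r) \<longlonglongrightarrow> l))"

definition pos_part :: "real \<Rightarrow> real" where
  "pos_part y = max y 0"

end

theory Submission
  imports Defs
begin

text \<open>
Write \<open>S\<close> for the set \<open>{x. f x \<le> 0}\<close> and \<open>d\<close> for the distance to \<open>S\<close>. The proof separates a soft
analytic part from a quantitative algebraic one.

The analytic part extracts two facts from the Palais-Smale condition. The distance \<open>d\<close> is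
bounded on every sublevel set of \<open>f\<close> (\<open>infdist_bounded_on_sublevel\<close>), and \<open>f\<close> is bounded away
from zero on each set \<open>{x. \<epsilon> \<le> d x}\<close> with \<open>\<epsilon> > 0\<close> (\<open>positive_away_from_sublevel\<close>). If one of
them failed, there would be points \<open>x\<close> for which \<open>f x\<close> is small compared with \<open>d x\<close>. Minimising
\<open>f\<close> plus a quadratic penalty on the ball of radius \<open>d x / 2\<close> about \<open>x\<close>, where \<open>f\<close> is positive,
gives a point with a Frechet subgradient of norm at most \<open>4 * M / d x\<close>, for any \<open>M > f x\<close>. These
points form a sequence with slope tending to zero, and a convergent subsequence of it
contradicts that its distances tend to infinity in the first case and that its limit would lie
in \<open>S\<close> in the second.

The algebraic part turns these facts into power bounds. A definable subset of the plane whose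
vertical sections are bounded above has sections bounded by a power of the abscissa near
infinity (\<open>definable_sections_polynomially_bounded\<close>): the set is a union of sign classes of
finitely many polynomials, and beyond a root bound, which grows polynomially, no sign changes
any more, so that a section reaching beyond it would be unbounded. Applied to the pairs \<open>(s, y)\<close>
such that \<open>f x \<le> s\<close> and \<open>y \<le> d x\<close> for some \<open>x\<close>, this bounds \<open>d\<close> by a power of \<open>f\<close> where \<open>f\<close> is
large. Applied to the pairs of reciprocals \<open>(1 / d, 1 / f)\<close>, it bounds a power of \<open>d\<close> by a
multiple of \<open>f\<close> where \<open>d\<close> is small. In the remaining region \<open>f\<close> has a positive lower bound and
\<open>d\<close> an upper bound.

Both sets are defined with quantifiers, so the Tarski-Seidenberg theorem is needed
(\<open>sign_definable_exists\<close>). It is proved by Hormander's elimination method, phrased with order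
isomorphisms: if the signs of suitable finitely many polynomials agree at two parameters, then
an increasing bijection of the line carries the signs of a given family at the one parameter to
those at the other (\<open>finitely_sign_determined_finite\<close>). The step that adds a polynomial \<open>u\<close> to a
family containing its derivative is \<open>sign_isomorphism_extends\<close>.
\<close>

section \<open>Order isomorphisms of the line preserving signs of polynomials\<close>

text \<open>
By induction on the largest prescribed point: beyond its predecessor the extension is the line
through both, so the result is piecewise linear.
\<close>

lemma strict_mono_on_finite_extends:
  fixes h :: "real \<Rightarrow> real"
  assumes "finite Z" "strict_mono_on Z h"
  shows "\<exists>H. strict_mono H \<and> surj H \<and> (\<forall>z\<in>Z. H z = h z)"
  using assms
proof (induction Z rule: finite_linorder_max_induct)
  case empty
  show ?case by (rule exI[of _ "\<lambda>x. x"]) (auto simp: strict_mono_def)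
next
  case (insert b A)
  have "strict_mono_on A h"
    using insert.prems by (auto simp: strict_mono_on_def)
  then obtain H where H: "strict_mono H" "surj H" "\<And>z. z \<in> A \<Longrightarrow> H z = h z"
    using insert.IH by blast
  show ?case
  proof (cases "A = {}")
    case True
    show ?thesis
      by (rule exI[of _ "\<lambda>x. x + (h b - b)"])
        (auto simp: True strict_mono_def surj_def intro!: exI[of _ "_ - (h b - b)"])
  next
    case False
    define m where "m = Max A"
    have mA: "m \<in> A" and le: "\<And>z. z \<in> A \<Longrightarrow> z \<le> m"
      using False insert.hyps(1) by (auto simp: m_def)
    have mb: "m < b" using mA insert.hyps(2) by blast
    have hmb: "h m < h b"
      using insert.prems mA mb by (auto simp: strict_mono_on_def)
    define c where "c = (h b - h m) / (b - m)"
    have c: "c > 0" using mb hmb by (simp add: c_def)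
    define H' where "H' = (\<lambda>x. if x \<le> m then H x else h m + c * (x - m))"
    have Hm: "H m = h m" using H(3) mA .
    have "strict_mono H'"
    proof (rule strict_monoI)
      fix x y :: real assume xy: "x < y"
      consider "y \<le> m" | "x \<le> m" "m < y" | "m < x" by linarith
      then show "H' x < H' y"
      proof cases
        case 1
        then show ?thesis using xy H(1) by (auto simp: H'_def strict_mono_def)
      next
        case 2
        have "H x \<le> H m" using H(1) 2(1) by (simp add: strict_mono_less_eq)
        moreover have "c * (y - m) > 0" using c 2 by simp
        ultimately show ?thesis using 2 Hm by (simp add: H'_def)
      next
        case 3
        then show ?thesis using xy c by (simp add: H'_def)
      qed
    qed
    moreover have "surj H'"
    proof (rule surjI)
      fix y
      show "H' (if y \<le> h m then inv H y else m + (y - h m) / c) = y"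
      proof (cases "y \<le> h m")
        case True
        have "H (inv H y) = y" using H(2) by (simp add: surj_f_inv_f)
        moreover have "inv H y \<le> m"
          using True calculation Hm H(1) by (metis strict_mono_less_eq)
        ultimately show ?thesis using True by (simp add: H'_def)
      next
        case False
        then have "\<not> m + (y - h m) / c \<le> m" using c by (simp add: not_le)
        then show ?thesis using False c by (simp add: H'_def)
      qed
    qed
    moreover have "\<forall>z\<in>insert b A. H' z = h z"
      using H(3) le mb by (auto simp: H'_def c_def)
    ultimately show ?thesis by blast
  qed
qed

lemma poly_sgn_eq_if_no_root:
  fixes p :: "real poly"
  assumes "\<And>z. min a b \<le> z \<Longrightarrow> z \<le> max a b \<Longrightarrow> poly p z \<noteq> 0"
  shows "sgn (poly p a) = sgn (poly p b)"
proof (rule ccontr)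
  assume ne: "sgn (poly p a) \<noteq> sgn (poly p b)"
  have nz: "poly p a \<noteq> 0" "poly p b \<noteq> 0" using assms[of a] assms[of b] by auto
  have "a \<noteq> b" using ne by auto
  then have "\<exists>z. min a b < z \<and> z < max a b \<and> poly p z = 0"
    using poly_IVT[of "min a b" "max a b" p] ne nz
    by (auto simp: sgn_if min_def max_def mult_less_0_iff split: if_splits)
  then show False using assms by (meson less_imp_le)
qed

lemma poly_eventually_pos_if_pderiv_pos:
  fixes v :: "real poly"
  assumes "\<And>t. t \<ge> a \<Longrightarrow> poly (pderiv v) t > 0"
  shows "\<exists>b>a. poly v b > 0"
proof -
  have lead: "lead_coeff (pderiv v) > 0"
  proof (rule ccontr)
    assume "\<not> lead_coeff (pderiv v) > 0"
    moreover have "pderiv v \<noteq> 0" using assms[of a] by auto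
    ultimately have "lead_coeff (- pderiv v) > 0"
      by (simp add: not_less order.order_iff_strict)
    then obtain n where n: "\<And>x. x \<ge> n \<Longrightarrow> poly (- pderiv v) x \<ge> lead_coeff (- pderiv v)"
      using poly_pinfty_gt_lc by blast
    have "poly (- pderiv v) (max n a) > 0"
      using n[of "max n a"] \<open>lead_coeff (- pderiv v) > 0\<close> by linarith
    then show False using assms[of "max n a"] by simp
  qed
  moreover have "degree v \<noteq> 0"
  proof
    assume "degree v = 0"
    then have "pderiv v = 0" by (simp add: pderiv_eq_0_iff)
    then show False using lead by simp
  qed
  ultimately have "lead_coeff v > 0"
    by (simp add: coeff_pderiv degree_pderiv zero_less_mult_iff)
  then obtain n where n: "\<And>x. x \<ge> n \<Longrightarrow> poly v x \<ge> lead_coeff v"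
    using poly_pinfty_gt_lc by blast
  show ?thesis
    using n[of "max n (a + 1)"] \<open>lead_coeff v > 0\<close>
    by (intro exI[of _ "max n (a + 1)"]) auto
qed

definition reflect :: "real poly \<Rightarrow> real poly" where
  "reflect p = pcompose p [:0, -1:]"

lemma poly_reflect [simp]: "poly (reflect p) x = poly p (- x)"
  by (simp add: reflect_def poly_pcompose)

lemma pderiv_reflect [simp]: "pderiv (reflect p) = - reflect (pderiv p)"
  by (simp add: reflect_def pderiv_pcompose pderiv_pCons)

text \<open>
The situation in which the sign behaviour of \<open>u\<close> can be compared with that of \<open>v\<close>: the bijection
\<open>h\<close> matches the signs of the derivatives everywhere, but those of \<open>u\<close> and \<open>v\<close> only at the
finitely many points of \<open>Y\<close>. As \<open>Y\<close> contains the critical points of \<open>u\<close>, both polynomials are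
strictly monotone, in the same direction, on each gap of \<open>Y\<close> and on its image.
\<close>

definition derivative_matched ::
  "(real \<Rightarrow> real) \<Rightarrow> real set \<Rightarrow> real poly \<Rightarrow> real poly \<Rightarrow> bool" where
  "derivative_matched h Y u v \<longleftrightarrow>
     strict_mono h \<and> surj h \<and> finite Y \<and> {x. poly (pderiv u) x = 0} \<subseteq> Y \<and>
     (\<forall>x. sgn (poly (pderiv u) x) = sgn (poly (pderiv v) (h x))) \<and>
     (\<forall>y\<in>Y. sgn (poly u y) = sgn (poly v (h y)))"

lemma derivative_matched_minus:
  assumes "derivative_matched h Y u v"
  shows "derivative_matched h Y (- u) (- v)"
  using assms by (simp add: derivative_matched_def pderiv_minus sgn_minus)

text \<open>
Negating the polynomials and reflecting the line are symmetries of this situation. They reduce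
the four combinations of the signs of \<open>u\<close> and of its derivative to one.
\<close>

lemma derivative_matched_reflect:
  assumes "derivative_matched h Y u v"
  shows "derivative_matched (\<lambda>x. - h (- x)) (uminus ` Y) (reflect u) (reflect v)"
proof -
  have mono: "strict_mono h" and surj: "surj h" and fin: "finite Y"
    and roots: "\<And>x. poly (pderiv u) x = 0 \<Longrightarrow> x \<in> Y"
    and signs: "\<And>x. sgn (poly (pderiv u) x) = sgn (poly (pderiv v) (h x))"
      "\<And>y. y \<in> Y \<Longrightarrow> sgn (poly u y) = sgn (poly v (h y))"
    using assms by (auto simp: derivative_matched_def)
  have "\<exists>x. y = - h (- x)" for y
  proof -
    obtain x where "- y = h x" using surj by (meson surjD)
    then show ?thesis by (intro exI[of _ "- x"]) simp
  qed
  moreover have "x \<in> uminus ` Y" if "poly (pderiv u) (- x) = 0" for x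
    using roots[OF that] by (intro image_eqI[of _ _ "- x"]) simp
  ultimately show ?thesis
    unfolding derivative_matched_def
    using mono fin signs by (auto simp: strict_mono_def sgn_minus surj_def)
qed

lemma pderiv_pos_on_gap:
  assumes m: "derivative_matched h Y u v"
    and gap: "\<And>z. z \<in> Y \<Longrightarrow> \<not> (min a b \<le> z \<and> z \<le> max a b)"
    and pos: "poly (pderiv u) a > 0"
  shows "poly (pderiv u) b > 0" "poly (pderiv v) (h b) > 0"
proof -
  have "sgn (poly (pderiv u) a) = sgn (poly (pderiv u) b)"
    using m gap by (intro poly_sgn_eq_if_no_root) (auto simp: derivative_matched_def)
  then show 1: "poly (pderiv u) b > 0" using pos by (simp add: sgn_1_pos)
  have "sgn (poly (pderiv u) b) = sgn (poly (pderiv v) (h b))"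
    using m by (simp add: derivative_matched_def)
  then show "poly (pderiv v) (h b) > 0" using 1 by (simp add: sgn_1_pos)
qed

text \<open>
If \<open>u\<close> increases through a root \<open>w\<close>, then it is positive at the next point of \<open>Z\<close>, hence so is
\<open>v\<close> at the image of that point. If there is no next point, then \<open>v\<close> increases on the unbounded
gap and so, being a polynomial, tends to infinity.
\<close>

lemma positive_value_right_of_root:
  assumes m: "derivative_matched h Z u v"
    and w: "poly u w = 0" "w \<notin> Z" "poly (pderiv u) w > 0"
  shows "\<exists>b>h w. poly v b > 0 \<and> (\<forall>z\<in>Z. w < z \<longrightarrow> b \<le> h z)"
proof (cases "\<exists>z\<in>Z. w < z")
  case False
  have "poly (pderiv v) t > 0" if "t \<ge> h w" for t
  proof -
    have "surj h" using m by (simp add: derivative_matched_def)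
    then obtain s where s: "t = h s" by (meson surjD)
    then have "w \<le> s" using that m by (simp add: derivative_matched_def strict_mono_less_eq)
    then have "poly (pderiv v) (h s) > 0"
      using False w by (intro pderiv_pos_on_gap(2)[OF m _ w(3)]) (auto simp: min_def max_def order_le_less)
    then show ?thesis using s by simp
  qed
  then show ?thesis using poly_eventually_pos_if_pderiv_pos[of "h w" v] False by blast
next
  case True
  define z where "z = Min {z \<in> Z. w < z}"
  have fin: "finite {z \<in> Z. w < z}" using m by (simp add: derivative_matched_def)
  have "z \<in> {z \<in> Z. w < z}" unfolding z_def using True fin by (intro Min_in) auto
  then have z: "z \<in> Z" "w < z" by auto
  have z_le: "z \<le> y" if "y \<in> Z" "w < y" for y
    unfolding z_def using that fin by (intro Min_le) auto
  obtain x where x: "w < x" "x < z" "poly u z - poly u w = (z - w) * poly (pderiv u) x"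
    using poly_MVT[OF z(2)] by blast
  have "poly (pderiv u) x > 0"
    using x z_le w by (intro pderiv_pos_on_gap(1)[OF m _ w(3)]) (force simp: order_le_less)
  then have "poly u z > 0" using x z w by simp
  then have "poly v (h z) > 0"
    using m z(1) by (auto simp: derivative_matched_def sgn_if split: if_splits)
  moreover have "h w < h z" using m z by (simp add: derivative_matched_def strict_mono_less)
  moreover have "h z \<le> h y" if "y \<in> Z" "w < y" for y
    using m z_le[OF that] by (simp add: derivative_matched_def strict_mono_less_eq)
  ultimately show ?thesis by blast
qed

lemma matching_root_increasing:
  assumes m: "derivative_matched h Z u v"
    and w: "poly u w = 0" "w \<notin> Z" "poly (pderiv u) w > 0"
  shows "\<exists>w'. poly v w' = 0 \<and> (\<forall>z\<in>Z. (z < w \<longrightarrow> h z < w') \<and> (w < z \<longrightarrow> w' < h z))"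
proof -
  obtain b where b: "b > h w" "poly v b > 0" "\<And>z. z \<in> Z \<Longrightarrow> w < z \<Longrightarrow> b \<le> h z"
    using positive_value_right_of_root[OF m w] by blast
  have m': "derivative_matched (\<lambda>x. - h (- x)) (uminus ` Z) (- reflect u) (- reflect v)"
    by (intro derivative_matched_minus derivative_matched_reflect m)
  have "\<exists>b>- h (- (- w)). poly (- reflect v) b > 0 \<and>
          (\<forall>z\<in>uminus ` Z. - w < z \<longrightarrow> b \<le> - h (- z))"
    using w by (intro positive_value_right_of_root[OF m']) (auto simp: pderiv_minus)
  then obtain a where a: "a > - h w" "poly v (- a) < 0" "\<And>z. z \<in> Z \<Longrightarrow> z < w \<Longrightarrow> h z \<le> - a"
    by force
  have "\<exists>x. - a < x \<and> x < b \<and> poly v x = 0"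
    using a b by (intro poly_IVT_pos) auto
  then obtain w' where "- a < w'" "w' < b" "poly v w' = 0" by blast
  then show ?thesis using a(3) b(3) by (meson order_le_less_trans order_less_le_trans)
qed

text \<open>
A root of \<open>u\<close> inside a gap of \<open>Z\<close> forces a root of \<open>v\<close> inside the corresponding gap, by the
intermediate value theorem. The bijection \<open>h\<close> itself need not map the one root to the other.
\<close>

lemma matching_root:
  assumes m: "derivative_matched h Z u v" and w: "poly u w = 0" "w \<notin> Z"
  shows "\<exists>w'. poly v w' = 0 \<and> (\<forall>z\<in>Z. (z < w \<longrightarrow> h z < w') \<and> (w < z \<longrightarrow> w' < h z))"
proof -
  have "poly (pderiv u) w \<noteq> 0" using m w by (auto simp: derivative_matched_def)
  then consider "poly (pderiv u) w > 0" | "poly (pderiv (- u)) w > 0"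
    by (fastforce simp: pderiv_minus)
  then show ?thesis
  proof cases
    case 1
    then show ?thesis using matching_root_increasing[OF m w] by blast
  next
    case 2
    then show ?thesis using matching_root_increasing[OF derivative_matched_minus[OF m]] w by simp
  qed
qed

text \<open>
Look at the last point \<open>y\<close> of \<open>Y\<close> before \<open>x\<close>. There \<open>u\<close> is nonnegative, because it has no root
between \<open>y\<close> and \<open>x\<close>; so \<open>v\<close> is nonnegative at \<open>h y\<close> and increases from there to \<open>h x\<close>. Such a
\<open>y\<close> exists, since otherwise \<open>u\<close> would increase on a whole half-line and have a root to the left
of \<open>x\<close>.
\<close>

lemma positive_value_transfers:
  assumes m: "derivative_matched h Y u v"
    and roots: "{x. poly u x = 0} \<subseteq> Y"
    and x: "x \<notin> Y" "poly u x > 0" "poly (pderiv u) x > 0"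
  shows "poly v (h x) > 0"
proof -
  have fin: "finite {y \<in> Y. y < x}" using m by (simp add: derivative_matched_def)
  have ne: "{y \<in> Y. y < x} \<noteq> {}"
  proof
    assume none: "{y \<in> Y. y < x} = {}"
    have "poly (pderiv (- reflect u)) t > 0" if "t \<ge> - x" for t
    proof -
      have "\<not> (min x (- t) \<le> z \<and> z \<le> max x (- t))" if "z \<in> Y" for z
        using none x(1) that \<open>t \<ge> - x\<close> by (force simp: min_def max_def order_le_less)
      then have "poly (pderiv u) (- t) > 0" by (rule pderiv_pos_on_gap(1)[OF m _ x(3)])
      then show ?thesis by (simp add: pderiv_minus)
    qed
    then obtain b where "b > - x" "poly (- reflect u) b > 0"
      using poly_eventually_pos_if_pderiv_pos by blast
    then have "\<exists>z. - b < z \<and> z < x \<and> poly u z = 0"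
      using x(2) by (intro poly_IVT_pos) auto
    then show False using none roots by blast
  qed
  define y where "y = Max {y \<in> Y. y < x}"
  have "y \<in> {y \<in> Y. y < x}" unfolding y_def using ne fin by (rule Max_in[rotated])
  then have y: "y \<in> Y" "y < x" by auto
  have gap: "\<not> (y < z \<and> z \<le> x)" if "z \<in> Y" for z
  proof
    assume z: "y < z \<and> z \<le> x"
    then have "z < x" using that x(1) by (cases "z = x") auto
    then have "z \<le> y" unfolding y_def using that fin by (intro Max_ge) auto
    then show False using z by simp
  qed
  have "poly u y \<ge> 0"
  proof (rule ccontr)
    assume "\<not> poly u y \<ge> 0"
    then have "\<exists>z. y < z \<and> z < x \<and> poly u z = 0"
      using x(2) y(2) by (intro poly_IVT_pos) auto
    then show False using gap roots by (meson less_imp_le mem_Collect_eq subset_iff)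
  qed
  then have vy: "poly v (h y) \<ge> 0"
    using m y(1) by (auto simp: derivative_matched_def sgn_if split: if_splits)
  have mono: "strict_mono h" and surj: "surj h" using m by (auto simp: derivative_matched_def)
  have "h y < h x" using mono y by (simp add: strict_mono_less)
  then obtain t where t: "h y < t" "t < h x"
      "poly v (h x) - poly v (h y) = (h x - h y) * poly (pderiv v) t"
    using poly_MVT by blast
  obtain s where s: "t = h s" using surj by (meson surjD)
  have "y < s" "s < x" using t s mono by (auto simp: strict_mono_less)
  then have "poly (pderiv v) (h s) > 0"
    using gap by (intro pderiv_pos_on_gap(2)[OF m _ x(3)]) force
  then show ?thesis using t s vy \<open>h y < h x\<close>
    by (metis add_pos_nonneg diff_add_cancel diff_gt_0_iff_gt mult_pos_pos)
qed

lemma sign_transfers: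
  assumes m: "derivative_matched h Y u v"
    and roots: "{x. poly u x = 0} \<subseteq> Y"
  shows "sgn (poly u x) = sgn (poly v (h x))"
proof (cases "x \<in> Y")
  case True
  then show ?thesis using m by (simp add: derivative_matched_def)
next
  case False
  have nz: "poly u x \<noteq> 0" "poly (pderiv u) x \<noteq> 0"
    using False roots m by (auto simp: derivative_matched_def)
  note mm = derivative_matched_minus[OF m]
  note mr = derivative_matched_reflect[OF m]
  note mmr = derivative_matched_minus[OF mr]
  have x': "- x \<notin> uminus ` Y" using False by auto
  have roots': "{x. poly (reflect u) x = 0} \<subseteq> uminus ` Y"
    using roots by (force simp: image_iff)
  consider "poly u x > 0" "poly (pderiv u) x > 0" | "poly u x < 0" "poly (pderiv u) x < 0"
    | "poly u x > 0" "poly (pderiv u) x < 0" | "poly u x < 0" "poly (pderiv u) x > 0"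
    using nz by linarith
  then show ?thesis
  proof cases
    case 1
    then show ?thesis using positive_value_transfers[OF m roots False] by simp
  next
    case 2
    then show ?thesis using positive_value_transfers[OF mm _ False] roots
      by (simp add: pderiv_minus)
  next
    case 3
    then show ?thesis using positive_value_transfers[OF mr roots' x'] by simp
  next
    case 4
    then show ?thesis using positive_value_transfers[OF mmr _ x'] roots'
      by (simp add: pderiv_minus)
  qed
qed

text \<open>
The inductive step of Hormander's elimination method. The roots of the polynomials \<open>p i\<close> cut the
line into gaps on which \<open>u\<close> is monotone, because its derivative is one of the \<open>p i\<close>. So the
signs of \<open>u\<close> at these roots and those of its derivative decide in which gaps \<open>u\<close> has a root, and
the same holds for \<open>v\<close>. Moving \<open>h\<close> within the gaps so that it carries these additional roots to
each other does not change the signs of the \<open>p i\<close>, and produces a bijection that respects \<open>u\<close> as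
well.
\<close>

lemma sign_isomorphism_extends:
  fixes p q :: "'i \<Rightarrow> real poly"
  assumes fin: "finite I" and h: "strict_mono h" "surj h"
    and signs: "\<And>i x. i \<in> I \<Longrightarrow> sgn (poly (p i) x) = sgn (poly (q i) (h x))"
    and k: "k \<in> I" "p k = pderiv u" "q k = pderiv v" "pderiv u \<noteq> 0"
    and at_roots: "\<And>i x. i \<in> I \<Longrightarrow> p i \<noteq> 0 \<Longrightarrow> poly (p i) x = 0 \<Longrightarrow>
      sgn (poly u x) = sgn (poly v (h x))"
  shows "\<exists>H. strict_mono H \<and> surj H \<and>
    (\<forall>i\<in>I. \<forall>x. sgn (poly (p i) x) = sgn (poly (q i) (H x))) \<and>
    (\<forall>x. sgn (poly u x) = sgn (poly v (H x)))"
proof -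
  define Z where "Z = (\<Union>i\<in>{i\<in>I. p i \<noteq> 0}. {x. poly (p i) x = 0})"
  have finZ: "finite Z" unfolding Z_def using fin by (auto intro: poly_roots_finite)
  have u0: "u \<noteq> 0" using k(4) by auto
  \<comment> \<open>The new nodes, at most one in each gap of \<open>Z\<close>, since \<open>u\<close> is monotone there.\<close>
  define W where "W = {w. poly u w = 0} - Z"
  have finW: "finite W" unfolding W_def using u0 poly_roots_finite by blast
  have mZ: "derivative_matched h Z u v"
    unfolding derivative_matched_def
  proof (intro conjI allI ballI h finZ)
    show "{x. poly (pderiv u) x = 0} \<subseteq> Z" using k by (auto simp: Z_def intro!: bexI[of _ k])
    show "sgn (poly (pderiv u) x) = sgn (poly (pderiv v) (h x))" for x
      using signs[OF k(1), of x] k by simp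
    show "sgn (poly u z) = sgn (poly v (h z))" if "z \<in> Z" for z
      using that at_roots by (auto simp: Z_def)
  qed
  have "\<forall>w\<in>W. \<exists>w'. poly v w' = 0 \<and> (\<forall>z\<in>Z. (z < w \<longrightarrow> h z < w') \<and> (w < z \<longrightarrow> w' < h z))"
    using matching_root[OF mZ] by (auto simp: W_def)
  then obtain f where f: "\<And>w. w \<in> W \<Longrightarrow> poly v (f w) = 0"
     "\<And>w z. w \<in> W \<Longrightarrow> z \<in> Z \<Longrightarrow> z < w \<Longrightarrow> h z < f w"
     "\<And>w z. w \<in> W \<Longrightarrow> z \<in> Z \<Longrightarrow> w < z \<Longrightarrow> f w < h z"
    unfolding bchoice_iff by blast
  define g where "g = (\<lambda>x. if x \<in> Z then h x else f x)"
  have "strict_mono_on (Z \<union> W) g"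
  proof (rule strict_mono_onI)
    fix r s assume rs: "r \<in> Z \<union> W" "s \<in> Z \<union> W" "r < s"
    show "g r < g s"
    proof (cases "r \<in> Z \<or> s \<in> Z")
      case True
      then show ?thesis using rs f h(1) by (auto simp: g_def strict_mono_less)
    next
      case False
      then have *: "r \<in> W" "s \<in> W" using rs by auto
      \<comment> \<open>Between two roots of \<open>u\<close> lies a root of its derivative, hence a point of \<open>Z\<close>.\<close>
      obtain z where z: "r < z" "z < s" "poly u s - poly u r = (s - r) * poly (pderiv u) z"
        using poly_MVT[OF rs(3)] by blast
      then have "poly (pderiv u) z = 0" using * rs(3) by (auto simp: W_def)
      then have "z \<in> Z" using mZ by (auto simp: derivative_matched_def)
      then show ?thesis using f(2)[OF *(2) _ z(2)] f(3)[OF *(1) _ z(1)] False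
        by (auto simp: g_def)
    qed
  qed
  then obtain H where H: "strict_mono H" "surj H" "\<And>x. x \<in> Z \<union> W \<Longrightarrow> H x = g x"
    using strict_mono_on_finite_extends[of "Z \<union> W" g] finZ finW by auto
  have HZ: "H z = h z" if "z \<in> Z" for z using H(3)[of z] that by (simp add: g_def)
  \<comment> \<open>The points \<open>h x\<close> and \<open>H x\<close> lie in the same gap of the image of \<open>Z\<close>.\<close>
  have signsH: "sgn (poly (p i) x) = sgn (poly (q i) (H x))" if i: "i \<in> I" for i x
  proof (cases "p i = 0 \<or> x \<in> Z")
    case True
    moreover have "poly (q i) y = 0" if "p i = 0" for y
    proof -
      obtain t where "y = h t" using h(2) by (meson surjD)
      then show ?thesis using signs[OF i, of t] that by (simp add: sgn_0_0)
    qed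
    ultimately show ?thesis using signs[OF i, of x] HZ by auto
  next
    case False
    have "poly (q i) y \<noteq> 0" if y: "min (h x) (H x) \<le> y" "y \<le> max (h x) (H x)" for y
    proof
      assume "poly (q i) y = 0"
      moreover obtain t where t: "y = h t" using h(2) by (meson surjD)
      ultimately have "poly (p i) t = 0" using signs[OF i, of t] by (simp add: sgn_0_0)
      then have tZ: "t \<in> Z" using i False by (auto simp: Z_def)
      then have "t \<noteq> x" using False by blast
      then have "(h t < h x \<and> H t < H x) \<or> (h x < h t \<and> H x < H t)"
        using h(1) H(1) by (auto simp: strict_mono_less)
      then show False using y t HZ[OF tZ] by auto
    qed
    then have "sgn (poly (q i) (h x)) = sgn (poly (q i) (H x))"
      by (rule poly_sgn_eq_if_no_root)
    then show ?thesis using signs[OF i] by simp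
  qed
  have mH: "derivative_matched H (Z \<union> W) u v"
    unfolding derivative_matched_def
  proof (intro conjI allI ballI H(1,2))
    show "finite (Z \<union> W)" using finZ finW by simp
    show "{x. poly (pderiv u) x = 0} \<subseteq> Z \<union> W"
      using mZ by (auto simp: derivative_matched_def)
    show "sgn (poly (pderiv u) x) = sgn (poly (pderiv v) (H x))" for x
      using signsH[OF k(1), of x] k by simp
    show "sgn (poly u y) = sgn (poly v (H y))" if "y \<in> Z \<union> W" for y
    proof (cases "y \<in> Z")
      case True
      then show ?thesis using mZ HZ by (simp add: derivative_matched_def)
    next
      case False
      then show ?thesis using that f(1) H(3)[of y] by (auto simp: g_def W_def)
    qed
  qed
  have "sgn (poly u x) = sgn (poly v (H x))" for x
    by (rule sign_transfers[OF mH]) (auto simp: W_def)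
  then show ?thesis using H signsH by blast
qed

section \<open>Polynomials with parametric coefficients\<close>

text \<open>
A polynomial in one distinguished variable whose coefficients are polynomials in the parameter
\<open>a\<close>. Its degree may drop at special values of the parameter, so degree bounds are stated as the
vanishing of the coefficients from some index on.
\<close>

definition polynomial_coefficients :: "('a::real_normed_vector \<Rightarrow> real poly) \<Rightarrow> bool" where
  "polynomial_coefficients P \<longleftrightarrow> (\<forall>i. real_polynomial_function (\<lambda>a. coeff (P a) i))"

definition same_signs :: "('a \<Rightarrow> real) set \<Rightarrow> 'a \<Rightarrow> 'a \<Rightarrow> bool" where
  "same_signs G a b \<longleftrightarrow> (\<forall>g\<in>G. sgn (g a) = sgn (g b))"

definition sign_isomorphic :: "('a \<Rightarrow> real poly) set \<Rightarrow> 'a \<Rightarrow> 'a \<Rightarrow> bool" where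
  "sign_isomorphic F a b \<longleftrightarrow> (\<exists>h. strict_mono h \<and> surj h \<and>
     (\<forall>P\<in>F. \<forall>x. sgn (poly (P a) x) = sgn (poly (P b) (h x))))"

text \<open>
The signs of finitely many polynomials in the parameters decide how the polynomials of the
family change their signs along the line. Order isomorphisms of the line replace explicit sign
diagrams.
\<close>

definition finitely_sign_determined :: "('a::real_normed_vector \<Rightarrow> real poly) set \<Rightarrow> bool" where
  "finitely_sign_determined F \<longleftrightarrow> (\<exists>G. finite G \<and> (\<forall>g\<in>G. real_polynomial_function g) \<and>
     (\<forall>a b. same_signs G a b \<longrightarrow> sign_isomorphic F a b))"

text \<open>
One step of pseudo-division of \<open>P\<close> by \<open>Q\<close>, where \<open>Q\<close> is regarded as having degree \<open>j\<close>.
Multiplying by the square of the leading coefficient keeps the sign of \<open>P\<close> at the roots of \<open>Q\<close>.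
The cut-off ensures that the degree falls below \<open>d\<close> for every parameter, also where \<open>Q\<close> has
larger degree.
\<close>

definition pseudo_reduct ::
  "nat \<Rightarrow> nat \<Rightarrow> ('a \<Rightarrow> real poly) \<Rightarrow> ('a \<Rightarrow> real poly) \<Rightarrow> 'a \<Rightarrow> real poly" where
  "pseudo_reduct d j P Q a =
     smult ((coeff (Q a) j)\<^sup>2) (P a)
     - monom (coeff (Q a) j * coeff (P a) d) (d - j) * poly_cutoff (Suc j) (Q a)"

lemma polynomial_coefficients_pseudo_reduct:
  assumes "polynomial_coefficients P" "polynomial_coefficients Q"
  shows "polynomial_coefficients (pseudo_reduct d j P Q)"
  unfolding polynomial_coefficients_def
proof
  fix i
  have P: "real_polynomial_function (\<lambda>a. coeff (P a) i)" for i
    using assms by (simp add: polynomial_coefficients_def)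
  have Q: "real_polynomial_function (\<lambda>a. coeff (Q a) i)" for i
    using assms by (simp add: polynomial_coefficients_def)
  show "real_polynomial_function (\<lambda>a. coeff (pseudo_reduct d j P Q a) i)"
    unfolding pseudo_reduct_def coeff_diff coeff_smult coeff_monom_mult coeff_poly_cutoff
    by (cases "i < d - j"; cases "i - (d - j) < Suc j")
      (auto intro!: real_polynomial_function_diff real_polynomial_function.intros(4)
        real_polynomial_function_power P Q real_polynomial_function.intros(2))
qed

lemma coeff_pseudo_reduct_eq_0:
  assumes "j \<le> d" "\<And>i. i \<ge> Suc d \<Longrightarrow> coeff (P a) i = 0" "i \<ge> d"
  shows "coeff (pseudo_reduct d j P Q a) i = 0"
proof (cases "i = d")
  case True
  then show ?thesis using assms(1)
    by (simp add: pseudo_reduct_def coeff_monom_mult coeff_poly_cutoff power2_eq_square)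
next
  case False
  then show ?thesis using assms
    by (simp add: pseudo_reduct_def coeff_monom_mult coeff_poly_cutoff)
qed

lemma sgn_pseudo_reduct_at_root:
  assumes "degree (Q a) = j" "Q a \<noteq> 0" "poly (Q a) x = 0"
  shows "sgn (poly (pseudo_reduct d j P Q a) x) = sgn (poly (P a) x)"
proof -
  have "poly_cutoff (Suc j) (Q a) = Q a"
    by (rule poly_eqI) (use assms(1) in \<open>auto simp: coeff_poly_cutoff coeff_eq_0\<close>)
  moreover have "coeff (Q a) j \<noteq> 0" using assms by auto
  ultimately show ?thesis
    using assms(3) by (auto simp: pseudo_reduct_def sgn_if zero_less_mult_iff mult_less_0_iff)
qed

text \<open>
The signs of a polynomial \<open>P\<close> of degree at most \<open>d\<close> are controlled by polynomials of smaller
degree besides those of \<open>F\<close>. Where the coefficient of order \<open>d\<close> vanishes, \<open>P\<close> agrees with its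
truncation. Elsewhere \<open>P\<close> is constant if \<open>d = 0\<close>, and otherwise the bijection can be extended to
\<open>P\<close>: the derivative of \<open>P\<close> takes part in it, and the sign of \<open>P\<close> at a root of another polynomial
\<open>Q\<close> is that of a pseudo-reduct by \<open>Q\<close>. The signs of the coefficients of \<open>Q\<close> ensure that \<open>Q\<close> has
the same degree at both parameters, so that the same pseudo-reduct serves for both.
\<close>

lemma finitely_sign_determined_insert:
  fixes F :: "('a::real_normed_vector \<Rightarrow> real poly) set"
  assumes fin: "finite F"
    and coeffs: "\<And>Q. Q \<in> insert P F \<Longrightarrow> polynomial_coefficients Q"
    and bound: "\<And>Q a i. Q \<in> insert P F \<Longrightarrow> i \<ge> Suc d \<Longrightarrow> coeff (Q a) i = 0"
    and det: "finitely_sign_determined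
      (F \<union> {\<lambda>a. poly_cutoff d (P a), \<lambda>a. pderiv (P a)} \<union>
       (\<lambda>(j, Q). pseudo_reduct d j P Q) ` ({..d} \<times> insert (\<lambda>a. pderiv (P a)) F))"
      (is "finitely_sign_determined ?F'")
  shows "finitely_sign_determined (insert P F)"
proof -
  obtain G where G: "finite G" "\<And>g. g \<in> G \<Longrightarrow> real_polynomial_function g"
      "\<And>a b. same_signs G a b \<Longrightarrow> sign_isomorphic ?F' a b"
    using det unfolding finitely_sign_determined_def by blast
  define D where "D = (\<lambda>a. pderiv (P a))"
  define C where "C = (\<lambda>(j, Q) a. coeff (Q a) j) ` ({..d} \<times> insert P (insert D F))"
  have D: "polynomial_coefficients D"
    using coeffs[of P] by (auto simp: D_def polynomial_coefficients_def coeff_pderiv)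
  have "sign_isomorphic (insert P F) a b" if ab: "same_signs (G \<union> C) a b" for a b
  proof -
    have "sign_isomorphic ?F' a b" using ab G(3) by (simp add: same_signs_def)
    then obtain h where h: "strict_mono h" "surj h"
      and hF': "\<And>Q x. Q \<in> ?F' \<Longrightarrow> sgn (poly (Q a) x) = sgn (poly (Q b) (h x))"
      unfolding sign_isomorphic_def by (elim exE conjE) (rule that, auto)
    have sgnC: "sgn (coeff (Q a) j) = sgn (coeff (Q b) j)"
      if "j \<le> d" "Q \<in> insert P (insert D F)" for j Q
    proof -
      have "(\<lambda>a. coeff (Q a) j) \<in> C" unfolding C_def using that by force
      then show ?thesis using ab unfolding same_signs_def by (metis UnI2)
    qed
    have hF: "sgn (poly (Q a) x) = sgn (poly (Q b) (h x))" if "Q \<in> insert D F" for Q x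
      using that by (intro hF') (auto simp: D_def)
    have D_bound: "coeff (D a) i = 0" if "i \<ge> d" for a i
      using that bound[of P] by (simp add: D_def coeff_pderiv)
    show ?thesis
    proof (cases "coeff (P a) d = 0 \<or> d = 0")
      case True
      have "sgn (poly (P a) x) = sgn (poly (P b) (h x))" for x
      proof (cases "coeff (P a) d = 0")
        case True
        moreover have "coeff (P b) d = 0" using sgnC[of d P] True by (simp add: sgn_0_0)
        moreover have "poly_cutoff d (P c) = P c" if "coeff (P c) d = 0" for c
        proof (rule poly_eqI)
          fix n
          consider "n < d" | "n = d" | "n \<ge> Suc d" by linarith
          then show "coeff (poly_cutoff d (P c)) n = coeff (P c) n"
            by cases (use that bound[of P] in \<open>auto simp: coeff_poly_cutoff\<close>)
        qed
        ultimately show ?thesis using hF'[of "\<lambda>a. poly_cutoff d (P a)" x] by simp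
      next
        case False
        then have d: "d = 0" using True by simp
        have const: "P c = [:coeff (P c) 0:]" for c
          using bound[of P] d by (intro poly_eqI) (auto simp: coeff_pCons split: nat.splits)
        have "poly (P c) y = coeff (P c) 0" for c y
          using arg_cong[OF const, of "\<lambda>p. poly p y" c] by simp
        then show ?thesis using sgnC[of 0 P] by simp
      qed
      then show ?thesis using h hF unfolding sign_isomorphic_def by blast
    next
      case False
      have "pderiv (P a) \<noteq> 0"
      proof
        assume "pderiv (P a) = 0"
        then have "coeff (pderiv (P a)) (d - 1) = 0" by simp
        then show False using False by (simp add: coeff_pderiv)
      qed
      moreover have "sgn (poly (P a) x) = sgn (poly (P b) (h x))"
        if Q: "Q \<in> insert D F" "Q a \<noteq> 0" "poly (Q a) x = 0" for Q x
      proof -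
        define j where "j = degree (Q a)"
        have Qbound: "coeff (Q c) i = 0" if "i \<ge> Suc d" for c i
          using Q(1) bound[of Q] D_bound that by auto
        have jd: "j \<le> d"
          unfolding j_def using Qbound[of _ a] by (meson degree_le not_less_eq_eq Suc_leI)
        have "sgn (coeff (Q b) j) = sgn (coeff (Q a) j)"
          using sgnC[OF jd] Q by auto
        moreover have "coeff (Q a) j \<noteq> 0" using Q by (simp add: j_def)
        ultimately have bj: "coeff (Q b) j \<noteq> 0" by (metis sgn_0_0)
        have "coeff (Q b) i = 0" if "i > j" for i
        proof (cases "i \<le> d")
          case True
          then have "sgn (coeff (Q b) i) = sgn (coeff (Q a) i)"
            using sgnC[OF True] Q by auto
          then show ?thesis using that by (simp add: j_def coeff_eq_0 sgn_0_0)
        qed (use Qbound in auto)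
        then have "degree (Q b) = j"
          using bj by (meson degree_le le_degree order_antisym)
        moreover have "poly (Q b) (h x) = 0"
          using hF[OF Q(1), of x] Q(3) by (simp add: sgn_0_0)
        moreover have "Q b \<noteq> 0" using bj by auto
        ultimately have "sgn (poly (pseudo_reduct d j P Q b) (h x)) = sgn (poly (P b) (h x))"
          by (intro sgn_pseudo_reduct_at_root)
        moreover have "sgn (poly (pseudo_reduct d j P Q a) x) = sgn (poly (P a) x)"
          using Q j_def by (intro sgn_pseudo_reduct_at_root) auto
        moreover have "pseudo_reduct d j P Q \<in> ?F'"
          using Q(1) jd by (force simp: D_def)
        ultimately show ?thesis using hF' by metis
      qed
      ultimately have "\<exists>H. strict_mono H \<and> surj H \<and>
          (\<forall>Q\<in>insert D F. \<forall>x. sgn (poly (Q a) x) = sgn (poly (Q b) (H x))) \<and>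
          (\<forall>x. sgn (poly (P a) x) = sgn (poly (P b) (H x)))"
        using fin h hF
        by (intro sign_isomorphism_extends[where k = D and h = h]) (auto simp: D_def)
      then show ?thesis unfolding sign_isomorphic_def by blast
    qed
  qed
  moreover have "finite (G \<union> C)" using G(1) fin by (simp add: C_def)
  moreover have "real_polynomial_function g" if "g \<in> G \<union> C" for g
    using that G(2) D coeffs by (force simp: C_def polynomial_coefficients_def)
  ultimately show ?thesis unfolding finitely_sign_determined_def by blast
qed

text \<open>
The outer induction is on the degree bound, the inner one on the set \<open>T\<close> of polynomials of
maximal degree. Removing one polynomial from \<open>T\<close> enlarges the set \<open>L\<close> of polynomials of lower
degree, which the inner induction therefore leaves arbitrary.
\<close>

theorem finitely_sign_determined_finite:
  fixes F :: "('a::real_normed_vector \<Rightarrow> real poly) set"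
  assumes "finite F" "\<And>P. P \<in> F \<Longrightarrow> polynomial_coefficients P"
    and "\<And>P a i. P \<in> F \<Longrightarrow> i \<ge> d \<Longrightarrow> coeff (P a) i = 0"
  shows "finitely_sign_determined F"
  using assms
proof (induction d arbitrary: F)
  case 0
  then have zero: "P a = 0" if "P \<in> F" for P a using that by (simp add: poly_eq_iff)
  have "sign_isomorphic F a b" for a b
    unfolding sign_isomorphic_def
    by (intro exI[of _ "\<lambda>x. x"]) (use zero in \<open>simp add: strict_mono_def, metis\<close>)
  then show ?case unfolding finitely_sign_determined_def by blast
next
  case (Suc d)
  have "finitely_sign_determined (L \<union> T)"
    if "finite T" "finite L" "\<And>P. P \<in> L \<union> T \<Longrightarrow> polynomial_coefficients P"
      "\<And>P a i. P \<in> L \<Longrightarrow> i \<ge> d \<Longrightarrow> coeff (P a) i = 0"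
      "\<And>P a i. P \<in> T \<Longrightarrow> i \<ge> Suc d \<Longrightarrow> coeff (P a) i = 0"
    for L T :: "('a \<Rightarrow> real poly) set"
    using that
  proof (induction T arbitrary: L rule: finite_induct)
    case empty
    then show ?case using Suc.IH[of L] by simp
  next
    case (insert P T)
    define D where "D = (\<lambda>a. pderiv (P a))"
    define N where "N = {\<lambda>a. poly_cutoff d (P a), D} \<union>
       (\<lambda>(j, Q). pseudo_reduct d j P Q) ` ({..d} \<times> insert D (L \<union> T))"
    have P: "polynomial_coefficients P" using insert.prems by blast
    have D: "polynomial_coefficients D"
      using P by (auto simp: D_def polynomial_coefficients_def coeff_pderiv)
    have cut: "polynomial_coefficients (\<lambda>a. poly_cutoff d (P a))"
      unfolding polynomial_coefficients_def
    proof
      fix i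
      show "real_polynomial_function (\<lambda>a. coeff (poly_cutoff d (P a)) i)"
        using P by (cases "i < d")
          (simp_all add: polynomial_coefficients_def coeff_poly_cutoff
            real_polynomial_function.intros(2))
    qed
    have coeffN: "polynomial_coefficients Q" if "Q \<in> N" for Q
      using that D cut P insert.prems(2)
      by (auto simp: N_def intro: polynomial_coefficients_pseudo_reduct)
    have boundN: "coeff (Q a) i = 0" if "Q \<in> N" "i \<ge> d" for Q a i
      using that insert.prems(4)[of P] coeff_pseudo_reduct_eq_0[of _ d P a i]
      by (auto simp: N_def D_def coeff_pderiv coeff_poly_cutoff)
    have "finite N" using insert.hyps(1) insert.prems(1) by (simp add: N_def)
    then have "finitely_sign_determined ((L \<union> N) \<union> T)"
      using insert.prems coeffN boundN by (intro insert.IH) auto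
    then have "finitely_sign_determined (insert P (L \<union> T))"
      using insert.prems insert.hyps(1)
      by (intro finitely_sign_determined_insert[where d = d]) (auto simp: N_def D_def Un_ac Suc_le_eq)
    then show ?case by simp
  qed
  from this[of F "{}"] show ?case using Suc.prems by simp
qed

section \<open>Definable sets and the projection theorem\<close>

text \<open>
The sets that are unions of sign classes of finitely many polynomials; these are the
semialgebraic sets. In this form closure under Boolean operations is immediate, and no normal
form of formulas has to be maintained when a quantifier is eliminated.
\<close>

definition sign_definable :: "'a::real_normed_vector set \<Rightarrow> bool" where
  "sign_definable A \<longleftrightarrow> (\<exists>G. finite G \<and> (\<forall>g\<in>G. real_polynomial_function g) \<and>
     (\<forall>a b. same_signs G a b \<longrightarrow> a \<in> A \<longrightarrow> b \<in> A))"

lemma sign_definableE: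
  assumes "sign_definable A"
  obtains G where "finite G" "\<And>g. g \<in> G \<Longrightarrow> real_polynomial_function g"
    "\<And>a b. same_signs G a b \<Longrightarrow> a \<in> A \<longleftrightarrow> b \<in> A"
proof -
  obtain G where G: "finite G" "\<And>g. g \<in> G \<Longrightarrow> real_polynomial_function g"
    "\<And>a b. same_signs G a b \<Longrightarrow> a \<in> A \<Longrightarrow> b \<in> A"
    using assms unfolding sign_definable_def by blast
  moreover have "same_signs G b a" if "same_signs G a b" for a b
    using that by (simp add: same_signs_def)
  ultimately show thesis by (intro that[of G]) blast+
qed

lemma sign_definable_Compl: "sign_definable A \<Longrightarrow> sign_definable (- A)"
  by (erule sign_definableE) (simp add: sign_definable_def, metis)

lemma sign_definable_Un:
  assumes "sign_definable A" "sign_definable B"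
  shows "sign_definable (A \<union> B)"
proof -
  obtain G where G: "finite G" "\<And>g. g \<in> G \<Longrightarrow> real_polynomial_function g"
    "\<And>a b. same_signs G a b \<Longrightarrow> a \<in> A \<longleftrightarrow> b \<in> A"
    using assms(1) by (rule sign_definableE) blast
  obtain H where H: "finite H" "\<And>g. g \<in> H \<Longrightarrow> real_polynomial_function g"
    "\<And>a b. same_signs H a b \<Longrightarrow> a \<in> B \<longleftrightarrow> b \<in> B"
    using assms(2) by (rule sign_definableE) blast
  have "same_signs G a b" "same_signs H a b" if "same_signs (G \<union> H) a b" for a b
    using that by (auto simp: same_signs_def)
  then have "a \<in> A \<union> B \<longrightarrow> b \<in> A \<union> B" if "same_signs (G \<union> H) a b" for a b
    using that G(3) H(3) by blast
  then show ?thesis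
    using G H unfolding sign_definable_def by (intro exI[of _ "G \<union> H"]) blast
qed

lemma sign_definable_Int:
  assumes "sign_definable A" "sign_definable B"
  shows "sign_definable (A \<inter> B)"
  using sign_definable_Compl[OF sign_definable_Un[OF sign_definable_Compl[OF assms(1)] sign_definable_Compl[OF assms(2)]]]
  by simp

lemma sign_definable_polynomial_sign:
  assumes "real_polynomial_function g"
  shows "sign_definable {x. R (sgn (g x))}"
  unfolding sign_definable_def
  by (rule exI[of _ "{g}"]) (auto simp: assms same_signs_def)

lemma sign_definable_pos: "real_polynomial_function g \<Longrightarrow> sign_definable {x. g x > 0}"
  using sign_definable_polynomial_sign[of g "\<lambda>s. s > 0"] by simp

lemma sign_definable_nonneg: "real_polynomial_function g \<Longrightarrow> sign_definable {x. g x \<ge> 0}"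
  using sign_definable_polynomial_sign[of g "\<lambda>s. s \<ge> 0"] by simp

lemma sign_definable_zero: "real_polynomial_function g \<Longrightarrow> sign_definable {x. g x = 0}"
  using sign_definable_polynomial_sign[of g "\<lambda>s. s = 0"] by (simp add: sgn_0_0)

lemma sign_definable_vimage:
  fixes T :: "'a::euclidean_space \<Rightarrow> 'b::euclidean_space"
  assumes "bounded_linear T" "sign_definable A"
  shows "sign_definable (T -` A)"
  using assms(2)
proof (rule sign_definableE)
  fix G assume G: "finite G" "\<And>g. g \<in> G \<Longrightarrow> real_polynomial_function g"
    "\<And>a b. same_signs G a b \<Longrightarrow> a \<in> A \<longleftrightarrow> b \<in> A"
  have "real_polynomial_function (g \<circ> T)" if "g \<in> G" for g
    using that G(2) assms(1) real_polynomial_function_compose polynomial_function_bounded_linear by blast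
  moreover have "same_signs G (T a) (T b)" if "same_signs ((\<lambda>g. g \<circ> T) ` G) a b" for a b
    using that by (auto simp: same_signs_def)
  ultimately show ?thesis
    using G(1) unfolding sign_definable_def
    by (intro exI[of _ "(\<lambda>g. g \<circ> T) ` G"]) (simp, metis G(3))
qed

lemma sign_definable_semialgebraic:
  assumes "semialgebraic A"
  shows "sign_definable A"
proof -
  have basic: "sign_definable B" if basic: "basic_semialgebraic B" for B :: "'a set"
  proof -
    obtain E P where EP: "finite E" "finite P" "\<And>g. g \<in> E \<union> P \<Longrightarrow> real_polynomial_function g"
       "B = {x. (\<forall>g\<in>E. g x = 0) \<and> (\<forall>g\<in>P. g x > 0)}"
      using basic unfolding basic_semialgebraic_def by blast
    have "y \<in> B" if "same_signs (E \<union> P) x y" "x \<in> B" for x y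
    proof -
      have "sgn (g x) = sgn (g y)" if "g \<in> E \<union> P" for g
        using that \<open>same_signs (E \<union> P) x y\<close> by (simp add: same_signs_def)
      then show ?thesis using \<open>x \<in> B\<close> unfolding EP(4)
        by (simp add: Ball_def) (metis sgn_0_0 sgn_1_pos)
    qed
    then show ?thesis using EP(1,2,3) unfolding sign_definable_def
      by (intro exI[of _ "E \<union> P"]) blast
  qed
  obtain \<A> where A: "finite \<A>" "\<And>B. B \<in> \<A> \<Longrightarrow> basic_semialgebraic B" "A = \<Union>\<A>"
    using assms unfolding semialgebraic_def by blast
  have "sign_definable (\<Union>\<B>)" if "finite \<B>" "\<B> \<subseteq> \<A>" for \<B>
    using that
  proof (induction \<B> rule: finite_induct)
    case empty
    have "sign_definable {x::'a. (0::real) > 0}"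
      by (rule sign_definable_pos) (rule real_polynomial_function.intros(2))
    then show ?case by simp
  next
    case (insert B \<B>)
    then show ?case using sign_definable_Un[of B "\<Union>\<B>"] basic A(2) by auto
  qed
  then show ?thesis using A by blast
qed

lemma polynomial_along_line:
  fixes g :: "'a::real_normed_vector \<Rightarrow> real"
  assumes "real_polynomial_function g"
  shows "\<exists>P d. polynomial_coefficients P \<and> (\<forall>a i. i \<ge> d \<longrightarrow> coeff (P a) i = 0) \<and>
    (\<forall>a r. poly (P a) r = g (a + r *\<^sub>R e))"
  using assms
proof (induction g rule: real_polynomial_function.induct)
  case (linear f)
  interpret f: bounded_linear f by fact
  have "real_polynomial_function (\<lambda>a. coeff [:f a, f e:] i)" for i
  proof (cases "i = 0")
    case True
    then show ?thesis using linear by (simp add: real_polynomial_function.intros(1))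
  next
    case False
    then have "(\<lambda>a. coeff [:f a, f e:] i) = (\<lambda>a. coeff [:f e:] (i - 1))"
      by (auto simp: coeff_pCons split: nat.splits)
    then show ?thesis by (simp add: real_polynomial_function.intros(2))
  qed
  then show ?case
    by (intro exI[of _ "\<lambda>a. [:f a, f e:]"] exI[of _ 2])
      (auto simp: polynomial_coefficients_def f.add f.scaleR coeff_pCons split: nat.splits)
next
  case (const c)
  show ?case
    by (intro exI[of _ "\<lambda>a. [:c:]"] exI[of _ 1])
      (auto simp: polynomial_coefficients_def coeff_pCons real_polynomial_function.intros(2)
        split: nat.splits)
next
  case (add f g)
  then obtain P d Q d' where
    P: "polynomial_coefficients P" "\<forall>a i. i \<ge> d \<longrightarrow> coeff (P a) i = 0"
      "\<forall>a r. poly (P a) r = f (a + r *\<^sub>R e)" and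
    Q: "polynomial_coefficients Q" "\<forall>a i. i \<ge> d' \<longrightarrow> coeff (Q a) i = 0"
      "\<forall>a r. poly (Q a) r = g (a + r *\<^sub>R e)" by blast
  show ?case
    using P Q by (intro exI[of _ "\<lambda>a. P a + Q a"] exI[of _ "max d d'"])
      (auto simp: polynomial_coefficients_def intro: real_polynomial_function.intros(3))
next
  case (mult f g)
  then obtain P d Q d' where
    P: "polynomial_coefficients P" "\<forall>a i. i \<ge> d \<longrightarrow> coeff (P a) i = 0"
      "\<forall>a r. poly (P a) r = f (a + r *\<^sub>R e)" and
    Q: "polynomial_coefficients Q" "\<forall>a i. i \<ge> d' \<longrightarrow> coeff (Q a) i = 0"
      "\<forall>a r. poly (Q a) r = g (a + r *\<^sub>R e)" by blast
  have "coeff (P a * Q a) i = 0" if "i \<ge> d + d'" for a i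
  proof -
    have "coeff (P a) j * coeff (Q a) (i - j) = 0" if "j \<le> i" for j
      using P(2) Q(2) that \<open>i \<ge> d + d'\<close> by (cases "j \<ge> d") auto
    then show ?thesis unfolding coeff_mult by (intro sum.neutral) auto
  qed
  moreover have "polynomial_coefficients (\<lambda>a. P a * Q a)"
    using P(1) Q(1) unfolding polynomial_coefficients_def coeff_mult
    by (auto intro!: real_polynomial_function_sum real_polynomial_function.intros(4))
  ultimately show ?case
    using P Q by (intro exI[of _ "\<lambda>a. P a * Q a"] exI[of _ "d + d'"]) auto
qed

text \<open>
Restricted to the lines in direction \<open>e\<close>, the polynomials describing \<open>A\<close> become a family with
parametric coefficients. If two parameters agree in the signs that control this family, then the
order isomorphism between the two lines carries points of \<open>A\<close> to points of \<open>A\<close>.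
\<close>

theorem sign_definable_project_line:
  fixes A :: "'a::real_normed_vector set"
  assumes "sign_definable A"
  shows "sign_definable {x. \<exists>r. x + r *\<^sub>R e \<in> A}"
  using assms
proof (rule sign_definableE)
  fix G assume G: "finite G" "\<And>g. g \<in> G \<Longrightarrow> real_polynomial_function g"
    "\<And>a b. same_signs G a b \<Longrightarrow> a \<in> A \<longleftrightarrow> b \<in> A"
  have "\<forall>g\<in>G. \<exists>P d. polynomial_coefficients P \<and> (\<forall>a i. i \<ge> d \<longrightarrow> coeff (P a) i = 0) \<and>
    (\<forall>a r. poly (P a) r = g (a + r *\<^sub>R e))"
    using polynomial_along_line G(2) by blast
  from this[unfolded bchoice_iff] obtain P where "\<forall>g\<in>G. \<exists>d. polynomial_coefficients (P g) \<and>
    (\<forall>a i. i \<ge> d \<longrightarrow> coeff (P g a) i = 0) \<and> (\<forall>a r. poly (P g a) r = g (a + r *\<^sub>R e))" by blast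
  then obtain d where "\<forall>g\<in>G. polynomial_coefficients (P g) \<and>
    (\<forall>a i. i \<ge> d g \<longrightarrow> coeff (P g a) i = 0) \<and> (\<forall>a r. poly (P g a) r = g (a + r *\<^sub>R e))"
    unfolding bchoice_iff by blast
  then have P: "\<And>g. g \<in> G \<Longrightarrow> polynomial_coefficients (P g)"
    "\<And>g a i. g \<in> G \<Longrightarrow> i \<ge> d g \<Longrightarrow> coeff (P g a) i = 0"
    "\<And>g a r. g \<in> G \<Longrightarrow> poly (P g a) r = g (a + r *\<^sub>R e)"
    by blast+
  have dle: "d g \<le> Max (d ` G)" if "g \<in> G" for g using that G(1) by simp
  have "finitely_sign_determined (P ` G)"
    using G(1) P(1) P(2)[OF _ order_trans[OF dle]]
    by (intro finitely_sign_determined_finite[where d = "Max (d ` G)"]) auto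
  then obtain H where H: "finite H" "\<And>g. g \<in> H \<Longrightarrow> real_polynomial_function g"
    "\<And>a b. same_signs H a b \<Longrightarrow> sign_isomorphic (P ` G) a b"
    unfolding finitely_sign_determined_def by blast
  have "\<exists>s. b + s *\<^sub>R e \<in> A" if ab: "same_signs H a b" "a + r *\<^sub>R e \<in> A" for a b r
  proof -
    obtain h where h: "\<forall>Q\<in>P ` G. \<forall>x. sgn (poly (Q a) x) = sgn (poly (Q b) (h x))"
      using H(3)[OF ab(1)] unfolding sign_isomorphic_def by blast
    have "same_signs G (a + r *\<^sub>R e) (b + h r *\<^sub>R e)"
      using h P(3) by (simp add: same_signs_def)
    then show ?thesis using G(3) ab(2) by blast
  qed
  then show ?thesis unfolding sign_definable_def
    using H(1,2) by (intro exI[of _ H]) blast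
qed

text \<open>
The Tarski-Seidenberg theorem. The space quantified over is spanned by finitely many vectors,
which are eliminated one direction at a time.
\<close>

theorem sign_definable_exists:
  fixes A :: "('a::euclidean_space \<times> 'b::euclidean_space) set"
  assumes "sign_definable A"
  shows "sign_definable {a. \<exists>b. (a, b) \<in> A}"
proof -
  have "sign_definable {x. \<exists>u\<in>span E. x + u \<in> A}" if "finite E" for E :: "('a \<times> 'b) set"
    using that
  proof (induction E rule: finite_induct)
    case empty
    then show ?case using assms by simp
  next
    case (insert e E)
    have "{x. \<exists>u\<in>span (insert e E). x + u \<in> A} = {x. \<exists>r. x + r *\<^sub>R e \<in> {x. \<exists>u\<in>span E. x + u \<in> A}}"
      (is "?L = ?R")
    proof (intro set_eqI iffI)
      fix x assume "x \<in> ?L"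
      then obtain u where u: "u \<in> span (insert e E)" "x + u \<in> A" by blast
      then obtain r where "u - r *\<^sub>R e \<in> span E" by (auto simp: span_insert)
      then show "x \<in> ?R" using u(2)
        by (auto intro!: exI[of _ r] bexI[of _ "u - r *\<^sub>R e"])
    next
      fix x assume "x \<in> ?R"
      then obtain r u where u: "u \<in> span E" "x + r *\<^sub>R e + u \<in> A" by blast
      then have "r *\<^sub>R e + u \<in> span (insert e E)"
        by (auto simp: span_insert intro!: exI[of _ r])
      then show "x \<in> ?L" using u(2) by (auto simp: add.assoc)
    qed
    then show ?case using sign_definable_project_line[OF insert.IH, of e] by simp
  qed
  from this[of "Pair 0 ` Basis"]
  have "sign_definable ((\<lambda>a. (a, 0)) -` {x. \<exists>u\<in>span (Pair 0 ` (Basis::'b set)). x + u \<in> A})"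
    by (intro sign_definable_vimage bounded_linear_Pair bounded_linear_ident bounded_linear_zero) simp
  moreover have "span (Pair (0::'a) ` (Basis::'b set)) = Pair 0 ` UNIV"
  proof -
    have "linear (Pair (0::'a) :: 'b \<Rightarrow> 'a \<times> 'b)"
      by (intro linearI) auto
    then show ?thesis by (simp add: linear_span_image)
  qed
  ultimately show ?thesis by (simp add: vimage_def)
qed

section \<open>Growth of definable subsets of the plane\<close>

lemma real_polynomial_function_upper_bound:
  fixes c :: "real \<Rightarrow> real"
  assumes "real_polynomial_function c"
  shows "\<exists>C N. C > 0 \<and> (\<forall>s\<ge>1. c s \<le> C * s ^ N)"
proof -
  obtain a n where c: "c = (\<lambda>x. \<Sum>i\<le>n. a i * x ^ i)"
    using assms real_polynomial_function_imp_sum by blast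
  define C where "C = (\<Sum>i\<le>n. \<bar>a i\<bar>) + 1"
  have "C > 0" unfolding C_def by (intro add_nonneg_pos sum_nonneg) auto
  moreover have "c s \<le> C * s ^ n" if s: "s \<ge> 1" for s
  proof -
    have "c s \<le> (\<Sum>i\<le>n. \<bar>a i\<bar> * s ^ n)"
      unfolding c
    proof (rule sum_mono)
      fix i assume "i \<in> {..n}"
      then have "s ^ i \<le> s ^ n" using s by (intro power_increasing) auto
      then have "\<bar>a i\<bar> * s ^ i \<le> \<bar>a i\<bar> * s ^ n" by (intro mult_left_mono) auto
      moreover have "a i * s ^ i \<le> \<bar>a i\<bar> * s ^ i"
        using s by (intro mult_right_mono) auto
      ultimately show "a i * s ^ i \<le> \<bar>a i\<bar> * s ^ n" by linarith
    qed
    also have "\<dots> \<le> C * s ^ n"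
      unfolding C_def using s by (simp add: sum_distrib_right[symmetric] distrib_right)
    finally show ?thesis .
  qed
  ultimately show ?thesis by blast
qed

text \<open>
A nonzero polynomial stays away from zero near infinity. The factor \<open>s\<close> absorbs the constant, so
that one inequality serves for all coefficients at once.
\<close>

lemma real_polynomial_function_lower_bound:
  fixes c :: "real \<Rightarrow> real"
  assumes "real_polynomial_function c" "c t \<noteq> 0"
  shows "\<forall>\<^sub>F s in at_top. 1 \<le> s * \<bar>c s\<bar>"
proof -
  obtain a n where c: "c = (\<lambda>x. \<Sum>i\<le>n. a i * x ^ i)"
    using assms real_polynomial_function_imp_sum by blast
  define p where "p = (\<Sum>i\<le>n. monom (a i) i)"
  have p: "poly p s = c s" for s by (simp add: p_def c poly_sum poly_monom)
  have "p \<noteq> 0" using p[of t] assms(2) by auto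
  then have L: "\<bar>lead_coeff p\<bar> > 0" by simp
  have "\<exists>m. \<forall>s\<ge>m. \<bar>lead_coeff p\<bar> \<le> \<bar>c s\<bar>"
  proof (cases "lead_coeff p > 0")
    case True
    from poly_pinfty_gt_lc[OF this] obtain m where "\<forall>s\<ge>m. lead_coeff p \<le> poly p s" by blast
    then show ?thesis using True p by (intro exI[of _ m]) fastforce
  next
    case False
    then have "lead_coeff (- p) > 0" using L by auto
    from poly_pinfty_gt_lc[OF this] obtain m where "\<forall>s\<ge>m. lead_coeff (- p) \<le> poly (- p) s" by blast
    then show ?thesis using False p by (intro exI[of _ m]) fastforce
  qed
  then obtain m where m: "\<And>s. s \<ge> m \<Longrightarrow> \<bar>lead_coeff p\<bar> \<le> \<bar>c s\<bar>" by blast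
  show ?thesis
  proof (rule eventually_at_top_linorderI)
    fix s assume s: "s \<ge> max m (1 / \<bar>lead_coeff p\<bar>)"
    then have "1 \<le> s * \<bar>lead_coeff p\<bar>" using L by (simp add: pos_divide_le_eq)
    also have "\<dots> \<le> s * \<bar>c s\<bar>"
      using s m[of s] L by (intro mult_left_mono) (auto intro: order_trans[rotated])
    finally show "1 \<le> s * \<bar>c s\<bar>" .
  qed
qed

lemma poly_nonzero_beyond_root_bound:
  fixes p :: "real poly"
  assumes "y \<ge> 1" "(\<Sum>i<degree p. \<bar>coeff p i\<bar>) < y * \<bar>lead_coeff p\<bar>"
  shows "poly p y \<noteq> 0"
proof
  let ?m = "degree p"
  assume "poly p y = 0"
  then have "lead_coeff p * y ^ ?m = - (\<Sum>i<?m. coeff p i * y ^ i)"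
    by (simp add: poly_altdef lessThan_Suc_atMost[symmetric])
  then have "\<bar>lead_coeff p * y ^ ?m\<bar> = \<bar>\<Sum>i<?m. coeff p i * y ^ i\<bar>" by simp
  then have "y * (\<bar>lead_coeff p\<bar> * y ^ ?m) = y * \<bar>\<Sum>i<?m. coeff p i * y ^ i\<bar>"
    using assms(1) by (simp add: abs_mult)
  also have "\<dots> \<le> y * (\<Sum>i<?m. \<bar>coeff p i * y ^ i\<bar>)"
    using assms(1) by (intro mult_left_mono sum_abs) auto
  also have "\<dots> = (\<Sum>i<?m. \<bar>coeff p i\<bar> * y ^ Suc i)"
    using assms(1) by (simp add: sum_distrib_left abs_mult mult_ac)
  also have "\<dots> \<le> (\<Sum>i<?m. \<bar>coeff p i\<bar> * y ^ ?m)"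
    using assms(1) by (intro sum_mono mult_left_mono power_increasing) auto
  also have "\<dots> = (\<Sum>i<?m. \<bar>coeff p i\<bar>) * y ^ ?m" by (simp add: sum_distrib_right)
  also have "\<dots> < (y * \<bar>lead_coeff p\<bar>) * y ^ ?m"
    using assms by (intro mult_strict_right_mono) auto
  finally show False by (simp add: mult_ac)
qed

text \<open>
Regard \<open>g\<close> as a polynomial in its second variable. For large \<open>s\<close> each coefficient is either
identically zero or at least \<open>1 / s\<close> in absolute value. Hence the classical bound for the roots
in terms of the quotients by the leading coefficient is itself bounded by a polynomial in \<open>s\<close>.
\<close>

lemma sign_eventually_constant:
  fixes g :: "real \<times> real \<Rightarrow> real"
  assumes "real_polynomial_function g"
  shows "\<exists>b. real_polynomial_function b \<and>
    (\<forall>\<^sub>F s in at_top. \<forall>y>b s. \<forall>y'>b s. sgn (g (s, y)) = sgn (g (s, y')))"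
proof -
  obtain P d where P: "polynomial_coefficients P" "\<And>a i. i \<ge> d \<Longrightarrow> coeff (P a) i = 0"
    "\<And>a r. poly (P a) r = g (a + r *\<^sub>R (0, 1))"
    using polynomial_along_line[OF assms, of "(0, 1)"] by blast
  define c where "c = (\<lambda>i s. coeff (P (s, 0)) i)"
  have c: "real_polynomial_function (c i)" for i
  proof -
    have "real_polynomial_function (\<lambda>a. coeff (P a) i)"
      using P(1) by (simp add: polynomial_coefficients_def)
    moreover have "polynomial_function (\<lambda>s::real. (s, 0::real))"
      by (intro polynomial_function_bounded_linear bounded_linear_Pair
          bounded_linear_ident bounded_linear_zero)
    ultimately have "real_polynomial_function ((\<lambda>a. coeff (P a) i) \<circ> (\<lambda>s. (s, 0)))"
      by (intro real_polynomial_function_compose)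
    then show ?thesis by (simp add: c_def o_def)
  qed
  \<comment> \<open>The term \<open>1 + (c i s)\<^sup>2\<close> is a polynomial bound for \<open>\<bar>c i s\<bar>\<close>.\<close>
  define b where "b = (\<lambda>s. 1 + s * (\<Sum>i<d. 1 + (c i s)\<^sup>2))"
  have "real_polynomial_function b"
    unfolding b_def
    by (intro real_polynomial_function.intros(2,3,4) real_polynomial_function_sum
        real_polynomial_function_power c) (auto intro: real_polynomial_function.intros(1) bounded_linear_ident)
  moreover have "\<forall>\<^sub>F s in at_top. \<forall>y>b s. \<forall>y'>b s. sgn (g (s, y)) = sgn (g (s, y'))"
  proof -
    have "\<forall>\<^sub>F s in at_top. c i s = 0 \<or> 1 \<le> s * \<bar>c i s\<bar>" for i
    proof (cases "\<exists>t. c i t \<noteq> 0")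
      case True
      then obtain t where "c i t \<noteq> 0" by blast
      from real_polynomial_function_lower_bound[OF c this] show ?thesis
        by (rule eventually_mono) simp
    qed auto
    then have "\<forall>\<^sub>F s in at_top. \<forall>i\<in>{..<d}. c i s = 0 \<or> 1 \<le> s * \<bar>c i s\<bar>"
      by (intro eventually_ball_finite) auto
    then show ?thesis
      using eventually_gt_at_top[of 0]
    proof eventually_elim
      case (elim s)
      define p where "p = P (s, 0)"
      have gp: "g (s, y) = poly p y" for y using P(3)[of "(s, 0)" y] by (simp add: p_def)
      have nz: "poly p y \<noteq> 0" if "y > b s" "p \<noteq> 0" for y
      proof (rule poly_nonzero_beyond_root_bound)
        have pos: "(\<Sum>i<d. 1 + (c i s)\<^sup>2) \<ge> 0" by (intro sum_nonneg) auto
        then show y1: "y \<ge> 1"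
          using that(1) elim mult_nonneg_nonneg[of s "\<Sum>i<d. 1 + (c i s)\<^sup>2"]
          unfolding b_def by linarith
        have deg: "degree p < d"
          using P(2)[of "degree p" "(s, 0)"] that(2) by (metis leading_coeff_0_iff not_le p_def)
        have "(\<Sum>i<degree p. \<bar>coeff p i\<bar>) \<le> (\<Sum>i<degree p. 1 + (c i s)\<^sup>2)"
        proof (rule sum_mono)
          fix i
          have "0 \<le> (\<bar>coeff p i\<bar> - 1)\<^sup>2" by simp
          then show "\<bar>coeff p i\<bar> \<le> 1 + (c i s)\<^sup>2"
            by (simp add: c_def p_def power2_eq_square algebra_simps abs_if split: if_splits)
        qed
        also have "\<dots> \<le> (\<Sum>i<d. 1 + (c i s)\<^sup>2)"
          using deg by (intro sum_mono2) auto
        also have "\<dots> \<le> (\<Sum>i<d. 1 + (c i s)\<^sup>2) * (s * \<bar>lead_coeff p\<bar>)"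
        proof -
          have "c (degree p) s \<noteq> 0" using that(2) by (simp add: c_def p_def)
          then have "1 \<le> s * \<bar>c (degree p) s\<bar>" using elim deg by auto
          then have "1 \<le> s * \<bar>lead_coeff p\<bar>" by (simp add: c_def p_def)
          from mult_left_mono[OF this pos] show ?thesis by simp
        qed
        also have "\<dots> = (s * (\<Sum>i<d. 1 + (c i s)\<^sup>2)) * \<bar>lead_coeff p\<bar>" by simp
        also have "\<dots> < y * \<bar>lead_coeff p\<bar>"
          using that unfolding b_def by (intro mult_strict_right_mono) auto
        finally show "(\<Sum>i<degree p. \<bar>coeff p i\<bar>) < y * \<bar>lead_coeff p\<bar>" .
      qed
      show ?case
      proof (intro allI impI)
        fix y y' assume "y > b s" "y' > b s"
        then have "sgn (poly p y) = sgn (poly p y')" if "p \<noteq> 0"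
          using nz that by (intro poly_sgn_eq_if_no_root) (auto simp: min_def split: if_splits)
        then show "sgn (g (s, y)) = sgn (g (s, y'))" by (cases "p = 0") (auto simp: gp)
      qed
    qed
  qed
  ultimately show ?thesis by blast
qed

text \<open>
Beyond the polynomial root bound, membership in a vertical section cannot change any more. A
section that is bounded above has therefore no element beyond the root bound.
\<close>

theorem definable_sections_polynomially_bounded:
  fixes A :: "(real \<times> real) set"
  assumes "sign_definable A"
    and bounded: "\<And>s. s > 0 \<Longrightarrow> \<exists>M. \<forall>y. (s, y) \<in> A \<longrightarrow> y \<le> M"
  shows "\<exists>C N T. C > 0 \<and> T \<ge> 1 \<and> (\<forall>s\<ge>T. \<forall>y. (s, y) \<in> A \<longrightarrow> y \<le> C * s ^ N)"
proof -
  obtain G where G: "finite G" "\<And>g. g \<in> G \<Longrightarrow> real_polynomial_function g"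
    "\<And>a b. same_signs G a b \<Longrightarrow> a \<in> A \<longleftrightarrow> b \<in> A"
    using assms(1) by (rule sign_definableE) blast
  have "\<forall>g\<in>G. \<exists>b. real_polynomial_function b \<and>
    (\<forall>\<^sub>F s in at_top. \<forall>y>b s. \<forall>y'>b s. sgn (g (s, y)) = sgn (g (s, y')))"
    using sign_eventually_constant G(2) by blast
  then obtain b where b: "\<And>g. g \<in> G \<Longrightarrow> real_polynomial_function (b g)"
    "\<And>g. g \<in> G \<Longrightarrow> \<forall>\<^sub>F s in at_top. \<forall>y>b g s. \<forall>y'>b g s. sgn (g (s, y)) = sgn (g (s, y'))"
    unfolding bchoice_iff by blast
  define B where "B = (\<lambda>s. \<Sum>g\<in>G. 1 + (b g s)\<^sup>2)"
  have bB: "b g s \<le> B s" if "g \<in> G" for g s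
  proof -
    have "0 \<le> (b g s - 1)\<^sup>2" by simp
    moreover have "0 \<le> (b g s)\<^sup>2" by simp
    ultimately have "b g s \<le> 1 + (b g s)\<^sup>2"
      unfolding power2_diff one_power2 mult_1_right by linarith
    also have "\<dots> \<le> B s"
      unfolding B_def using that G(1) by (intro member_le_sum) auto
    finally show ?thesis .
  qed
  have "real_polynomial_function B"
    unfolding B_def
    by (intro real_polynomial_function_sum real_polynomial_function.intros(2,3)
        real_polynomial_function_power b G(1))
  then obtain C N where CN: "C > 0" "\<And>s. s \<ge> 1 \<Longrightarrow> B s \<le> C * s ^ N"
    using real_polynomial_function_upper_bound by blast
  have "\<forall>\<^sub>F s in at_top. \<forall>g\<in>G. \<forall>y>b g s. \<forall>y'>b g s. sgn (g (s, y)) = sgn (g (s, y'))"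
    using b(2) G(1) by (intro eventually_ball_finite) auto
  then obtain T where T: "\<And>s g y y'. s \<ge> T \<Longrightarrow> g \<in> G \<Longrightarrow> y > b g s \<Longrightarrow> y' > b g s \<Longrightarrow>
      sgn (g (s, y)) = sgn (g (s, y'))"
    unfolding eventually_at_top_linorder by blast
  have "y \<le> C * s ^ N" if s: "s \<ge> max 1 T" and y: "(s, y) \<in> A" for s y
  proof (rule ccontr)
    assume "\<not> y \<le> C * s ^ N"
    then have yB: "y > B s" using CN(2)[of s] s by linarith
    obtain M where M: "\<And>y. (s, y) \<in> A \<Longrightarrow> y \<le> M" using bounded[of s] s by auto
    define y' where "y' = max y (M + 1)"
    have "same_signs G (s, y) (s, y')"
      unfolding same_signs_def
    proof
      fix g assume g: "g \<in> G"
      have "b g s < y" using bB[OF g, of s] yB by linarith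
      then show "sgn (g (s, y)) = sgn (g (s, y'))"
        using s by (intro T g) (auto simp: y'_def)
    qed
    then have "(s, y') \<in> A" using G(3) y by blast
    then show False using M[of y'] by (simp add: y'_def)
  qed
  then show ?thesis using CN(1) by (intro exI[of _ C] exI[of _ N] exI[of _ "max 1 T"]) auto
qed

section \<open>Consequences of the Palais-Smale condition\<close>

text \<open>
Minimise \<open>f y + (M / \<rho>\<^sup>2) * (norm (y - x0))\<^sup>2\<close> over the closed ball of radius \<open>\<rho>\<close>. On the
boundary this function is at least \<open>M\<close>, which exceeds its value at the centre, so the minimum is
attained inside, and there the negative gradient of the quadratic term is a Frechet subgradient
of \<open>f\<close>.
\<close>

lemma frechet_subgradient_near:
  fixes f :: "'a::euclidean_space \<Rightarrow> real"
  assumes cont: "continuous_on UNIV f" and \<rho>: "\<rho> > 0"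
    and nonneg: "\<And>y. dist x0 y \<le> \<rho> \<Longrightarrow> f y \<ge> 0" and M: "f x0 < M"
  shows "\<exists>x v. dist x0 x \<le> \<rho> \<and> f x \<le> f x0 \<and> v \<in> frechet_subdifferential f x \<and> norm v \<le> 2 * M / \<rho>"
proof -
  define K where "K = M / \<rho>\<^sup>2"
  define g where "g = (\<lambda>y. f y + K * (norm (y - x0))\<^sup>2)"
  have "M > 0" using nonneg[of x0] M \<rho> by simp
  then have K: "K > 0" using \<rho> by (simp add: K_def)
  have "continuous_on (cball x0 \<rho>) g"
    unfolding g_def by (intro continuous_intros continuous_on_subset[OF cont]) auto
  then obtain x where x: "x \<in> cball x0 \<rho>" "\<And>y. y \<in> cball x0 \<rho> \<Longrightarrow> g x \<le> g y"
    using continuous_attains_inf[of "cball x0 \<rho>" g] \<rho> by (metis compact_cball cball_eq_empty not_less less_imp_le)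
  have gx: "g x \<le> f x0" using x(2)[of x0] \<rho> by (simp add: g_def)
  have fx: "f x \<le> f x0"
    using gx K by (simp add: g_def) (smt (verit) mult_nonneg_nonneg zero_le_power2)
  have "norm (x - x0) < \<rho>"
  proof (rule ccontr)
    assume "\<not> norm (x - x0) < \<rho>"
    then have "norm (x - x0) = \<rho>" using x(1) by (simp add: dist_norm norm_minus_commute)
    then have "g x = f x + M" using \<rho> by (simp add: g_def K_def)
    moreover have "f x \<ge> 0" using x(1) nonneg by simp
    ultimately show False using gx M by simp
  qed
  then have int: "x \<in> ball x0 \<rho>" by (simp add: dist_norm norm_minus_commute)
  define v where "v = - (2 * K) *\<^sub>R (x - x0)"
  have "eventually (\<lambda>h. x + h \<in> ball x0 \<rho>) (at 0)"
  proof -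
    have "((\<lambda>h. x + h) \<longlongrightarrow> x + 0) (at 0)" by (intro tendsto_intros)
    then show ?thesis using int by (auto dest: topological_tendstoD[OF _ open_ball])
  qed
  then have "eventually (\<lambda>h. ereal (- K * norm h) \<le> ereal ((f (x + h) - f x - v \<bullet> h) / norm h)) (at 0)"
    using eventually_at_ball'[OF zero_less_one, of "0::'a" UNIV]
  proof (eventually_elim)
    case (elim h)
    then have h: "norm h > 0" by auto
    have "g x \<le> g (x + h)" using x(2)[of "x + h"] elim by simp
    moreover have "(norm (x + h - x0))\<^sup>2 = (norm (x - x0))\<^sup>2 + 2 * ((x - x0) \<bullet> h) + (norm h)\<^sup>2"
      by (simp add: power2_norm_eq_inner inner_diff_left inner_diff_right inner_add_left inner_add_right
          inner_commute algebra_simps)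
    then have "K * (norm (x + h - x0))\<^sup>2 =
        K * (norm (x - x0))\<^sup>2 + 2 * K * ((x - x0) \<bullet> h) + K * (norm h)\<^sup>2"
      by (simp add: distrib_left)
    moreover have "v \<bullet> h = - (2 * K * ((x - x0) \<bullet> h))"
      unfolding v_def inner_scaleR_left by simp
    ultimately have "f (x + h) - f x - v \<bullet> h \<ge> - K * (norm h)\<^sup>2"
      unfolding g_def by linarith
    then have "(f (x + h) - f x - v \<bullet> h) / norm h \<ge> (- K * (norm h)\<^sup>2) / norm h"
      using h by (intro divide_right_mono) auto
    then show ?case using h by (simp add: power2_eq_square)
  qed
  then have "Liminf (at 0) (\<lambda>h::'a. ereal (- K * norm h)) \<le>
      Liminf (at 0) (\<lambda>h. ereal ((f (x + h) - f x - v \<bullet> h) / norm h))"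
    by (rule Liminf_mono)
  moreover have "Liminf (at 0) (\<lambda>h::'a. ereal (- K * norm h)) = ereal (- K * norm (0::'a))"
    by (intro lim_imp_Liminf tendsto_intros) auto
  ultimately have "v \<in> frechet_subdifferential f x"
    by (simp add: frechet_subdifferential_def zero_ereal_def)
  moreover have "norm v \<le> 2 * M / \<rho>"
  proof -
    have "norm v = 2 * K * norm (x - x0)" using K by (simp add: v_def)
    also have "\<dots> \<le> 2 * K * \<rho>" using K \<open>norm (x - x0) < \<rho>\<close> by simp
    also have "\<dots> = 2 * M / \<rho>" using \<rho> by (simp add: K_def power2_eq_square)
    finally show ?thesis .
  qed
  ultimately show ?thesis using fx x(1) by auto
qed

text \<open>
Frechet subgradients are limiting subgradients, as constant sequences show, so their norms bound
the nonsmooth slope from above.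
\<close>

lemma palais_smale_at_frechet:
  fixes f :: "'a::euclidean_space \<Rightarrow> real"
  assumes "palais_smale_at f t" "(\<lambda>k. f (X k)) \<longlonglongrightarrow> t"
    and V: "\<And>k. V k \<in> frechet_subdifferential f (X k)" "(\<lambda>k. norm (V k)) \<longlonglongrightarrow> 0"
  shows "\<exists>r l. strict_mono (r :: nat \<Rightarrow> nat) \<and> (X \<circ> r) \<longlonglongrightarrow> l"
proof -
  have lim: "V k \<in> limiting_subdifferential f (X k)" for k
    unfolding limiting_subdifferential_def
  proof (intro CollectI exI conjI allI)
    show "V k \<in> frechet_subdifferential f ((\<lambda>_. X k) i)" for i :: nat using V(1) .
    show "(\<lambda>_::nat. (X k, f (X k))) \<longlonglongrightarrow> (X k, f (X k))" by simp
    show "strict_mono (\<lambda>n::nat. n)" by (simp add: strict_mono_def)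
    show "((\<lambda>_. V k) \<circ> (\<lambda>n::nat. n)) \<longlonglongrightarrow> V k" by (simp add: o_def)
  qed
  have "(\<lambda>k. nonsmooth_slope f (X k)) \<longlonglongrightarrow> 0"
  proof (rule tendsto_sandwich[of "\<lambda>_. 0" _ _ "\<lambda>k. ereal (norm (V k))"])
    show "\<forall>\<^sub>F k in sequentially. 0 \<le> nonsmooth_slope f (X k)"
      by (intro always_eventually allI) (auto simp: nonsmooth_slope_def intro!: INF_greatest)
    show "\<forall>\<^sub>F k in sequentially. nonsmooth_slope f (X k) \<le> ereal (norm (V k))"
      by (intro always_eventually allI) (auto simp: nonsmooth_slope_def intro: INF_lower lim)
    show "(\<lambda>k. ereal (norm (V k))) \<longlonglongrightarrow> 0"
      using tendsto_ereal[OF V(2)] by (simp add: zero_ereal_def)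
  qed simp
  then show ?thesis using assms(1,2) unfolding palais_smale_at_def by blast
qed

text \<open>
A point far from the sublevel set at a low level yields a nearby point with a short subgradient.
The two lemmas below apply it to sequences: the distance tends to infinity in the first, the
level to zero in the second.
\<close>

lemma nearly_critical_point:
  fixes f :: "'a::euclidean_space \<Rightarrow> real"
  assumes cont: "continuous_on UNIV f" and \<rho>: "\<rho> > 0"
    and far: "infdist x {x. f x \<le> 0} \<ge> 2 * \<rho>" and M: "f x < M"
  shows "\<exists>z v. infdist z {x. f x \<le> 0} \<ge> \<rho> \<and> 0 < f z \<and> f z \<le> f x \<and>
    v \<in> frechet_subdifferential f z \<and> norm v \<le> 2 * M / \<rho>"
proof -
  let ?S = "{x. f x \<le> 0}"
  have near: "infdist y ?S \<ge> \<rho>" if "dist x y \<le> \<rho>" for y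
    using infdist_triangle[of x ?S y] that far by linarith
  have pos: "f y > 0" if "infdist y ?S \<ge> \<rho>" for y
    using that \<rho> infdist_zero[of y ?S] by (cases "f y \<le> 0") auto
  have "f y \<ge> 0" if "dist x y \<le> \<rho>" for y using pos near that by (simp add: less_imp_le)
  from frechet_subgradient_near[OF cont \<rho> this M]
  obtain z v where "dist x z \<le> \<rho>" "f z \<le> f x" "v \<in> frechet_subdifferential f z" "norm v \<le> 2 * M / \<rho>"
    by blast
  then show ?thesis using near pos by blast
qed

lemma infdist_bounded_on_sublevel:
  fixes f :: "'a::euclidean_space \<Rightarrow> real"
  assumes cont: "continuous_on UNIV f" and ps: "\<And>t. t \<ge> 0 \<Longrightarrow> palais_smale_at f t"
  shows "\<exists>B. \<forall>x. f x \<le> s \<longrightarrow> infdist x {x. f x \<le> 0} \<le> B"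
proof (rule ccontr)
  let ?S = "{x. f x \<le> 0}"
  assume no: "\<not> ?thesis"
  have "\<exists>z v. infdist z ?S \<ge> real (Suc k) \<and> 0 < f z \<and> f z \<le> s \<and>
      v \<in> frechet_subdifferential f z \<and> norm v \<le> 2 * (s + 1) / real (Suc k)" for k
  proof -
    obtain x where x: "f x \<le> s" "\<not> infdist x ?S \<le> 2 * real (Suc k)" using no by blast
    have "\<exists>z v. infdist z ?S \<ge> real (Suc k) \<and> 0 < f z \<and> f z \<le> f x \<and>
      v \<in> frechet_subdifferential f z \<and> norm v \<le> 2 * (s + 1) / real (Suc k)"
      using x by (intro nearly_critical_point[OF cont]) auto
    then show ?thesis using x(1) by force
  qed
  from allI[OF this] have "\<exists>Z V. \<forall>k. infdist (Z k) ?S \<ge> real (Suc k) \<and> 0 < f (Z k) \<and> f (Z k) \<le> s \<and>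
      V k \<in> frechet_subdifferential f (Z k) \<and> norm (V k) \<le> 2 * (s + 1) / real (Suc k)"
    by (simp only: choice_iff)
  then obtain Z V where Z: "\<And>k. infdist (Z k) ?S \<ge> real (Suc k)" "\<And>k. 0 < f (Z k)" "\<And>k. f (Z k) \<le> s"
    and V: "\<And>k. V k \<in> frechet_subdifferential f (Z k)" "\<And>k. norm (V k) \<le> 2 * (s + 1) / real (Suc k)"
    by blast
  have "\<forall>k. f (Z k) \<in> {0..s}" using Z(2,3) by (simp add: less_imp_le)
  then obtain t r where r: "t \<in> {0..s}" "strict_mono r" "((\<lambda>k. f (Z k)) \<circ> r) \<longlonglongrightarrow> t"
    by (rule seq_compactE[OF compact_imp_seq_compact[OF compact_Icc]])
  have "(\<lambda>k. norm (V k)) \<longlonglongrightarrow> 0"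
    by (rule Lim_null_comparison[OF always_eventually
          LIMSEQ_Suc[OF lim_const_over_n[of "2 * (s + 1)"]]]) (simp only: real_norm_def abs_norm_cancel V(2) simp_thms)
  then have "(\<lambda>k. norm (V (r k))) \<longlonglongrightarrow> 0"
    using LIMSEQ_subseq_LIMSEQ[OF _ r(2)] by (auto simp: o_def)
  then obtain q l where q: "strict_mono (q :: nat \<Rightarrow> nat)" "((\<lambda>k. Z (r k)) \<circ> q) \<longlonglongrightarrow> l"
    using palais_smale_at_frechet[of f t "\<lambda>k. Z (r k)" "\<lambda>k. V (r k)"] ps r V(1)
    by (auto simp: o_def)
  have "(\<lambda>k. infdist (Z (r (q k))) ?S) \<longlonglongrightarrow> infdist l ?S"
    using q(2) by (intro tendsto_infdist) (simp add: o_def)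
  then have "\<forall>\<^sub>F k in sequentially. infdist (Z (r (q k))) ?S < infdist l ?S + 1"
    by (rule order_tendstoD) simp
  moreover have "\<forall>\<^sub>F k in sequentially. infdist l ?S + 1 < real k"
    by (rule eventually_gt_at_top[THEN filterlim_real_sequentially[unfolded filterlim_iff, rule_format]])
  ultimately have "\<forall>\<^sub>F k in sequentially. False"
  proof eventually_elim
    case (elim k)
    have "k \<le> r (q k)" using r(2) q(1) by (meson order_trans seq_suble)
    then have "real k \<le> infdist (Z (r (q k))) ?S" using Z(1)[of "r (q k)"] by linarith
    then show False using elim by linarith
  qed
  then show False by simp
qed

lemma positive_away_from_sublevel:
  fixes f :: "'a::euclidean_space \<Rightarrow> real"
  assumes cont: "continuous_on UNIV f" and ps: "palais_smale_at f 0" and \<epsilon>: "\<epsilon> > 0"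
  shows "\<exists>\<delta>>0. \<forall>x. \<epsilon> \<le> infdist x {x. f x \<le> 0} \<longrightarrow> \<delta> \<le> f x"
proof (rule ccontr)
  let ?S = "{x. f x \<le> 0}"
  assume no: "\<not> ?thesis"
  have "\<exists>z v. infdist z ?S \<ge> \<epsilon> / 2 \<and> 0 < f z \<and> f z \<le> 1 / real (Suc k) \<and>
      v \<in> frechet_subdifferential f z \<and> norm v \<le> (4 / \<epsilon>) / real (Suc k)" for k
  proof -
    have "1 / real (Suc k) > 0" by simp
    then obtain x where x: "\<epsilon> \<le> infdist x ?S" "\<not> 1 / real (Suc k) \<le> f x" using no by blast
    have "\<exists>z v. infdist z ?S \<ge> \<epsilon> / 2 \<and> 0 < f z \<and> f z \<le> f x \<and>
      v \<in> frechet_subdifferential f z \<and> norm v \<le> 2 * (1 / real (Suc k)) / (\<epsilon> / 2)"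
      using x \<epsilon> by (intro nearly_critical_point[OF cont]) auto
    then obtain z v where "infdist z ?S \<ge> \<epsilon> / 2" "0 < f z" "f z \<le> f x"
      "v \<in> frechet_subdifferential f z" "norm v \<le> 2 * (1 / real (Suc k)) / (\<epsilon> / 2)" by blast
    moreover have "2 * (1 / real (Suc k)) / (\<epsilon> / 2) = (4 / \<epsilon>) / real (Suc k)" by simp
    moreover have "f z \<le> 1 / real (Suc k)" using calculation(3) x(2) by linarith
    ultimately show ?thesis by metis
  qed
  from allI[OF this] have "\<exists>Z V. \<forall>k. infdist (Z k) ?S \<ge> \<epsilon> / 2 \<and> 0 < f (Z k) \<and> f (Z k) \<le> 1 / real (Suc k) \<and>
      V k \<in> frechet_subdifferential f (Z k) \<and> norm (V k) \<le> (4 / \<epsilon>) / real (Suc k)"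
    by (simp only: choice_iff)
  then obtain Z V where Z: "\<And>k. infdist (Z k) ?S \<ge> \<epsilon> / 2" "\<And>k. 0 < f (Z k)" "\<And>k. f (Z k) \<le> 1 / real (Suc k)"
    and V: "\<And>k. V k \<in> frechet_subdifferential f (Z k)" "\<And>k. norm (V k) \<le> (4 / \<epsilon>) / real (Suc k)"
    by blast
  have V0: "(\<lambda>k. norm (V k)) \<longlonglongrightarrow> 0"
    by (rule Lim_null_comparison[OF always_eventually
          LIMSEQ_Suc[OF lim_const_over_n[of "4 / \<epsilon>"]]]) (simp only: real_norm_def abs_norm_cancel V(2) simp_thms)
  have f0: "(\<lambda>k. f (Z k)) \<longlonglongrightarrow> 0"
    by (rule Lim_null_comparison[OF always_eventually LIMSEQ_Suc[OF lim_const_over_n[of 1]]])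
      (simp only: real_norm_def abs_of_pos Z(2,3) simp_thms)
  obtain q l where q: "strict_mono (q :: nat \<Rightarrow> nat)" "(Z \<circ> q) \<longlonglongrightarrow> l"
    using palais_smale_at_frechet[OF ps f0 V(1) V0] by blast
  have "(\<lambda>k. infdist ((Z \<circ> q) k) ?S) \<longlonglongrightarrow> infdist l ?S"
    using q(2) by (intro tendsto_infdist)
  then have far: "infdist l ?S \<ge> \<epsilon> / 2"
    by (rule LIMSEQ_le_const) (use Z(1) in auto)
  have "isCont f l" using cont by (simp add: continuous_on_eq_continuous_at)
  then have "(\<lambda>k. f ((Z \<circ> q) k)) \<longlonglongrightarrow> f l" using q(2) by (rule isCont_tendsto_compose)
  moreover have "(\<lambda>k. f ((Z \<circ> q) k)) \<longlonglongrightarrow> 0"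
    using LIMSEQ_subseq_LIMSEQ[OF f0 q(1)] by (simp add: o_def)
  ultimately have "f l = 0" by (rule LIMSEQ_unique)
  then have "infdist l ?S = 0" by (intro infdist_zero) simp
  then show False using far \<epsilon> by simp
qed

section \<open>The error bound\<close>

lemma real_polynomial_function_linear:
  fixes T :: "'a::euclidean_space \<Rightarrow> real"
  shows "linear T \<Longrightarrow> real_polynomial_function T"
  by (simp add: linear_conv_bounded_linear real_polynomial_function.intros(1))

lemma sign_definable_linear_vimage:
  fixes T :: "'a::euclidean_space \<Rightarrow> 'b::euclidean_space"
  assumes "sign_definable A" "linear T"
  shows "sign_definable {x. T x \<in> A}"
  using sign_definable_vimage[of T A] assms
  by (simp add: linear_conv_bounded_linear vimage_def)

text \<open>
The epigraph is the projection of \<open>{((x, c), w). w = f x \<and> w \<le> c}\<close>.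
\<close>

lemma sign_definable_epigraph:
  fixes f :: "'a::euclidean_space \<Rightarrow> real"
  assumes "semialgebraic_fun f"
  shows "sign_definable {(x, c). f x \<le> c}"
proof -
  let ?T = "\<lambda>p::('a \<times> real) \<times> real. (fst (fst p), snd p)"
  have "linear ?T" "linear (\<lambda>p::('a \<times> real) \<times> real. snd (fst p) - snd p)"
    by (intro linearI; simp add: algebra_simps)+
  then have "sign_definable ({p. ?T p \<in> {(x, y). y = f x}} \<inter> {p. snd (fst p) - snd p \<ge> 0})"
    using assms unfolding semialgebraic_fun_def
    by (intro sign_definable_Int sign_definable_linear_vimage sign_definable_nonneg
        sign_definable_semialgebraic real_polynomial_function_linear)
  from sign_definable_exists[OF this] show ?thesis
    by (simp add: case_prod_unfold)
qed

lemma le_infdist_iff: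
  assumes "S \<noteq> {}"
  shows "y \<le> infdist x S \<longleftrightarrow> (\<forall>z\<in>S. y \<le> dist x z)"
proof
  assume "\<forall>z\<in>S. y \<le> dist x z"
  then show "y \<le> infdist x S" using assms by (simp add: infdist_notempty cINF_greatest)
qed (use infdist_le[of _ S x] in \<open>force intro: order_trans\<close>)

text \<open>
For positive \<open>y\<close> the condition says that no point of \<open>S\<close> has squared distance to \<open>x\<close> smaller
than \<open>y\<^sup>2\<close>, and squared distances are polynomial.
\<close>

lemma sign_definable_far_points:
  fixes S :: "'a::euclidean_space set"
  assumes S: "sign_definable S" "S \<noteq> {}"
  shows "sign_definable {(x, y). 0 < y \<and> y \<le> infdist x S}"
proof -
  let ?q = "\<lambda>p::('a \<times> real) \<times> 'a. (snd (fst p))\<^sup>2 -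
      (\<Sum>i\<in>Basis. ((fst (fst p) - snd p) \<bullet> i)\<^sup>2)"
  have "linear (\<lambda>p::('a \<times> real) \<times> 'a. (fst (fst p) - snd p) \<bullet> i)" for i
    by (intro linearI; simp add: algebra_simps)
  moreover have "linear (\<lambda>p::('a \<times> real) \<times> 'a. snd (fst p))"
    "linear (snd :: ('a \<times> real) \<times> 'a \<Rightarrow> 'a)" "linear (snd :: 'a \<times> real \<Rightarrow> real)"
    by (intro linearI; simp)+
  ultimately have near: "sign_definable ({p. snd p \<in> S} \<inter> {p. ?q p > 0})"
    and pos: "sign_definable {p::'a \<times> real. snd p > 0}"
    using S(1)
    by (intro sign_definable_Int sign_definable_linear_vimage sign_definable_pos
        real_polynomial_function_diff real_polynomial_function_power
        real_polynomial_function_sum real_polynomial_function_linear; simp)+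
  from sign_definable_Int[OF pos sign_definable_Compl[OF sign_definable_exists[OF near]]]
  have "sign_definable ({p. snd p > 0} \<inter> - {a. \<exists>b. (a, b) \<in> {p. snd p \<in> S} \<inter> {p. ?q p > 0}})" .
  also have "{p. snd p > 0} \<inter> - {a. \<exists>b. (a, b) \<in> {p. snd p \<in> S} \<inter> {p. ?q p > 0}} =
      {(x, y). 0 < y \<and> y \<le> infdist x S}"
  proof -
    have "?q ((x, y), z) > 0 \<longleftrightarrow> \<not> y \<le> dist x z" if "y > 0" for x z y
    proof -
      have "(\<Sum>i\<in>Basis. ((x - z) \<bullet> i)\<^sup>2) = (dist x z)\<^sup>2"
        unfolding dist_norm power2_norm_eq_inner euclidean_inner[of "x - z" "x - z"]
        by (simp only: power2_eq_square)
      moreover have "y\<^sup>2 \<le> (dist x z)\<^sup>2 \<longleftrightarrow> y \<le> dist x z"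
        using that by (intro power_mono_iff) auto
      ultimately show ?thesis by auto
    qed
    then show ?thesis by (auto simp: le_infdist_iff[OF S(2)])
  qed
  finally show ?thesis .
qed

text \<open>
The growth theorem for the set of all \<open>(s, y)\<close> such that some point of the sublevel set of level
\<open>s\<close> has distance at least \<open>y\<close> from \<open>S\<close>.
\<close>

lemma infdist_polynomially_bounded:
  fixes f :: "'a::euclidean_space \<Rightarrow> real"
  assumes E: "sign_definable {(x, c). f x \<le> c}" and S: "sign_definable S" "S \<noteq> {}"
    and bounded: "\<And>s. \<exists>B. \<forall>x. f x \<le> s \<longrightarrow> infdist x S \<le> B"
  shows "\<exists>C N T. C > 0 \<and> T \<ge> 1 \<and> (\<forall>x. f x \<ge> T \<longrightarrow> infdist x S \<le> C * f x ^ N)"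
proof -
  let ?A = "{(s, y). \<exists>x. f x \<le> s \<and> 0 < y \<and> y \<le> infdist x S}"
  have "linear (\<lambda>p::(real \<times> real) \<times> 'a. (snd p, fst (fst p)))"
    "linear (\<lambda>p::(real \<times> real) \<times> 'a. (snd p, snd (fst p)))"
    by (intro linearI; simp)+
  then have "sign_definable ({p::(real \<times> real) \<times> 'a. (snd p, fst (fst p)) \<in> {(x, c). f x \<le> c}} \<inter>
      {p. (snd p, snd (fst p)) \<in> {(x, y). 0 < y \<and> y \<le> infdist x S}})"
    using E S by (intro sign_definable_Int sign_definable_linear_vimage sign_definable_far_points)
  from sign_definable_exists[OF this] have A: "sign_definable ?A"
    by (simp add: case_prod_unfold)
  have sections: "\<exists>M. \<forall>y. (s, y) \<in> ?A \<longrightarrow> y \<le> M" for s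
  proof -
    obtain B where "\<And>x. f x \<le> s \<Longrightarrow> infdist x S \<le> B" using bounded by blast
    then show ?thesis by (intro exI[of _ B]) force
  qed
  from definable_sections_polynomially_bounded[OF A sections]
  obtain C N T where CNT: "C > 0" "T \<ge> 1" "\<forall>s\<ge>T. \<forall>y. (s, y) \<in> ?A \<longrightarrow> y \<le> C * s ^ N"
    by (elim exE conjE)
  have "infdist x S \<le> C * f x ^ N" if "f x \<ge> T" for x
  proof (cases "infdist x S > 0")
    case True
    then show ?thesis using that by (intro CNT(3)[rule_format]) auto
  next
    case False
    moreover have "C * f x ^ N \<ge> 0" using CNT that by simp
    ultimately show ?thesis by linarith
  qed
  then show ?thesis using CNT by blast
qed

text \<open>
The same growth theorem, read at zero by passing to reciprocals: it is applied to the set of all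
\<open>(s, y)\<close> such that some point at distance at least \<open>1 / s\<close> from \<open>S\<close> has value at most \<open>1 / y\<close>.
Its sections are bounded above because \<open>f\<close> is bounded away from zero on the points at distance
at least \<open>1 / s\<close>.
\<close>

lemma infdist_power_bounded:
  fixes f :: "'a::euclidean_space \<Rightarrow> real"
  assumes E: "sign_definable {(x, c). f x \<le> c}" and S: "sign_definable S" "S \<noteq> {}"
    and away: "\<And>\<epsilon>. \<epsilon> > 0 \<Longrightarrow> \<exists>\<delta>>0. \<forall>x. \<epsilon> \<le> infdist x S \<longrightarrow> \<delta> \<le> f x"
  shows "\<exists>C N \<epsilon>. C > 0 \<and> \<epsilon> > 0 \<and> \<epsilon> \<le> 1 \<and>
    (\<forall>x. 0 < infdist x S \<and> infdist x S \<le> \<epsilon> \<longrightarrow> infdist x S ^ N \<le> C * f x)"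
proof -
  let ?A = "{(s, y). \<exists>x d c. s * d = 1 \<and> y * c = 1 \<and> (0 < d \<and> d \<le> infdist x S) \<and> f x \<le> c}"
  let ?s = "\<lambda>p::(real \<times> real) \<times> 'a \<times> real \<times> real. fst (fst p)"
  let ?y = "\<lambda>p::(real \<times> real) \<times> 'a \<times> real \<times> real. snd (fst p)"
  let ?x = "\<lambda>p::(real \<times> real) \<times> 'a \<times> real \<times> real. fst (snd p)"
  let ?d = "\<lambda>p::(real \<times> real) \<times> 'a \<times> real \<times> real. fst (snd (snd p))"
  let ?c = "\<lambda>p::(real \<times> real) \<times> 'a \<times> real \<times> real. snd (snd (snd p))"
  have lin: "linear ?s" "linear ?y" "linear ?d" "linear ?c"
    "linear (\<lambda>p. (?x p, ?d p))" "linear (\<lambda>p. (?x p, ?c p))"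
    by (intro linearI; simp)+
  have "sign_definable ({p. ?s p * ?d p - 1 = 0} \<inter> {p. ?y p * ?c p - 1 = 0} \<inter>
      {p. (?x p, ?d p) \<in> {(x, y). 0 < y \<and> y \<le> infdist x S}} \<inter>
      {p. (?x p, ?c p) \<in> {(x, c). f x \<le> c}})"
    using E S lin
    by (intro sign_definable_Int sign_definable_zero real_polynomial_function_diff
        real_polynomial_function.intros(2,4) real_polynomial_function_linear
        sign_definable_linear_vimage sign_definable_far_points)
  from sign_definable_exists[OF this] have "sign_definable ?A"
    by (simp add: case_prod_unfold)
  moreover have "\<exists>M. \<forall>y. (s, y) \<in> ?A \<longrightarrow> y \<le> M" if s: "s > 0" for s
  proof -
    obtain \<delta> where \<delta>: "\<delta> > 0" "\<And>x. 1 / s \<le> infdist x S \<Longrightarrow> \<delta> \<le> f x"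
      using away[of "1 / s"] s by auto
    have "y \<le> 1 / \<delta>" if y: "(s, y) \<in> ?A" for y
    proof -
      obtain x d c where *: "s * d = 1" "y * c = 1" "d \<le> infdist x S" "f x \<le> c" using y by blast
      have "d = 1 / s" using *(1) s by (simp add: field_simps)
      then have c: "\<delta> \<le> c" using * \<delta>(2)[of x] by simp
      then have "y = 1 / c" using *(2) \<delta>(1) by (simp add: field_simps)
      then show ?thesis using c \<delta>(1) by (simp add: frac_le)
    qed
    then show ?thesis by blast
  qed
  ultimately have "\<exists>C N T. C > 0 \<and> T \<ge> 1 \<and> (\<forall>s\<ge>T. \<forall>y. (s, y) \<in> ?A \<longrightarrow> y \<le> C * s ^ N)"
    by (rule definable_sections_polynomially_bounded)
  then obtain C N T where CNT: "C > 0" "T \<ge> 1" "\<forall>s\<ge>T. \<forall>y. (s, y) \<in> ?A \<longrightarrow> y \<le> C * s ^ N"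
    by (elim exE conjE)
  have "infdist x S ^ N \<le> C * f x" if d: "0 < infdist x S" "infdist x S \<le> 1 / T" for x
  proof -
    let ?d = "infdist x S"
    obtain \<delta> where "\<delta> > 0" "\<delta> \<le> f x" using away[OF d(1)] by blast
    then have f: "f x > 0" by simp
    have "1 / f x \<le> C * (1 / ?d) ^ N"
    proof (rule CNT(3)[rule_format])
      show "T \<le> 1 / ?d" using d CNT(2) by (simp add: field_simps)
      have "1 / ?d * ?d = 1 \<and> 1 / f x * f x = 1 \<and> (0 < ?d \<and> ?d \<le> infdist x S) \<and> f x \<le> f x"
        using d f by simp
      then show "(1 / ?d, 1 / f x) \<in> ?A" by blast
    qed
    then show ?thesis using d f by (simp add: power_divide field_simps)
  qed
  then show ?thesis using CNT by (intro exI[of _ C] exI[of _ N] exI[of _ "1 / T"]) auto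
qed

theorem theorem3:
  fixes f :: "real ^ 'n \<Rightarrow> real"
  assumes "continuous_on UNIV f"
    and "semialgebraic_fun f"
    and "{x. f x \<le> 0} \<noteq> {}"
    and "\<And>t. t \<ge> 0 \<Longrightarrow> palais_smale_at f t"
  shows "\<exists>c \<alpha> \<beta> :: real. c > 0 \<and> \<alpha> > 0 \<and> \<beta> > 0 \<and>
    (\<forall>x. c * infdist x {x. f x \<le> 0} \<le> pos_part (f x) powr \<alpha> + pos_part (f x) powr \<beta>)"
proof -
  let ?S = "{x. f x \<le> 0}"
  have E: "sign_definable {(x, c). f x \<le> c}" by (rule sign_definable_epigraph[OF assms(2)])
  have "linear (\<lambda>x::real ^ 'n. (x, 0::real))" by (intro linearI) simp_all
  from sign_definable_linear_vimage[OF E this] have S: "sign_definable ?S" by simp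
  have bounded: "\<exists>B. \<forall>x. f x \<le> s \<longrightarrow> infdist x ?S \<le> B" for s
    using infdist_bounded_on_sublevel[OF assms(1,4)] .
  have away: "\<exists>\<delta>>0. \<forall>x. \<epsilon> \<le> infdist x ?S \<longrightarrow> \<delta> \<le> f x" if "\<epsilon> > 0" for \<epsilon>
    using positive_away_from_sublevel[OF assms(1) assms(4)[of 0] that] by simp
  obtain C N T where large: "C > 0" "T \<ge> 1" "\<And>x. f x \<ge> T \<Longrightarrow> infdist x ?S \<le> C * f x ^ N"
    using infdist_polynomially_bounded[OF E S assms(3) bounded] by blast
  obtain D M \<epsilon> where small: "D > 0" "\<epsilon> > 0" "\<epsilon> \<le> 1"
    "\<And>x. 0 < infdist x ?S \<Longrightarrow> infdist x ?S \<le> \<epsilon> \<Longrightarrow> infdist x ?S ^ M \<le> D * f x"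
    using infdist_power_bounded[OF E S assms(3) away] by blast
  obtain \<delta> where \<delta>: "\<delta> > 0" "\<And>x. \<epsilon> \<le> infdist x ?S \<Longrightarrow> \<delta> \<le> f x" using away[OF small(2)] by blast
  obtain B where B: "\<And>x. f x \<le> T \<Longrightarrow> infdist x ?S \<le> B" using bounded[of T] by blast
  \<comment> \<open>The successors make both exponents positive even if \<open>M\<close> or \<open>N\<close> is zero.\<close>
  define \<alpha> where "\<alpha> = 1 / real (Suc M)"
  define \<beta> where "\<beta> = real (Suc N)"
  \<comment> \<open>One entry for each region: \<open>f\<close> large, the distance small, and neither.\<close>
  define K where "K = Max {C, D powr \<alpha>, B / \<delta> powr \<alpha>}"
  have K: "C \<le> K" "D powr \<alpha> \<le> K" "B / \<delta> powr \<alpha> \<le> K" by (simp_all add: K_def)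
  have K0: "K > 0" using K(1) large(1) by linarith
  have \<alpha>: "\<alpha> > 0" by (simp add: \<alpha>_def)
  have main: "infdist x ?S \<le> K * (f x powr \<alpha> + f x powr \<beta>)" if f: "f x > 0" for x
  proof -
    let ?d = "infdist x ?S"
    consider "?d = 0" | "0 < ?d" "?d \<le> \<epsilon>" | "\<epsilon> \<le> ?d" "f x \<le> T" | "f x \<ge> T"
      using infdist_nonneg[of x ?S] by linarith
    then have "?d \<le> K * f x powr \<alpha> \<or> ?d \<le> K * f x powr \<beta>"
    proof cases
      case 1
      then show ?thesis using K0 by simp
    next
      case 2
      have "?d ^ Suc M \<le> ?d ^ M" using 2 small(3) by (intro power_decreasing) auto
      also have "\<dots> \<le> D * f x" using small(4) 2 by blast
      finally have "(?d ^ Suc M) powr \<alpha> \<le> (D * f x) powr \<alpha>"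
        using \<alpha> 2 by (intro powr_mono2) auto
      moreover have "(?d ^ Suc M) powr \<alpha> = ?d"
      proof -
        have "(?d ^ Suc M) powr \<alpha> = (?d powr real (Suc M)) powr \<alpha>"
          using 2 by (simp only: powr_realpow)
        also have "\<dots> = ?d powr (real (Suc M) * \<alpha>)" by (rule powr_powr)
        also have "\<dots> = ?d" using 2 by (simp add: \<alpha>_def)
        finally show ?thesis .
      qed
      ultimately have "?d \<le> D powr \<alpha> * f x powr \<alpha>"
        using small(1) f by (simp add: powr_mult)
      also have "\<dots> \<le> K * f x powr \<alpha>" using K(2) by (intro mult_right_mono) auto
      finally show ?thesis by simp
    next
      case 3
      have "?d \<le> B" using B 3 by blast
      also have "\<dots> = (B / \<delta> powr \<alpha>) * \<delta> powr \<alpha>" using \<delta>(1) by simp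
      also have "\<dots> \<le> K * \<delta> powr \<alpha>" using K(3) by (intro mult_right_mono) auto
      also have "\<dots> \<le> K * f x powr \<alpha>"
        using \<delta> 3 \<alpha> K0 by (intro mult_left_mono powr_mono2) auto
      finally show ?thesis by simp
    next
      case 4
      have "?d \<le> C * f x ^ N" using large(3) 4 by blast
      also have "\<dots> \<le> K * f x ^ N" using K(1) f by (intro mult_right_mono) auto
      also have "\<dots> \<le> K * f x ^ Suc N"
        using K0 4 large(2) by (intro mult_left_mono power_increasing) auto
      also have "f x ^ Suc N = f x powr \<beta>" using f by (simp only: \<beta>_def powr_realpow)
      finally show ?thesis by simp
    qed
    then show ?thesis
      using K0 by (simp add: distrib_left) (smt (verit) mult_nonneg_nonneg powr_ge_zero)
  qed
  have "1 / K * infdist x ?S \<le> pos_part (f x) powr \<alpha> + pos_part (f x) powr \<beta>" for x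
  proof (cases "f x > 0")
    case True
    then show ?thesis using main[OF True] K0 by (simp add: pos_part_def field_simps)
  next
    case False
    then have "infdist x ?S = 0" by (intro infdist_zero) simp
    then show ?thesis by simp
  qed
  then show ?thesis using K0 \<alpha> by (intro exI[of _ "1 / K"] exI[of _ \<alpha>] exI[of _ \<beta>]) (auto simp: \<beta>_def)
qed

end
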